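(* Let $d\ge 1$ and let $0\ne f\in\mathbb{C}[\mathbb{Z}^d]$. Then the $N$th renormalized decimations $\mathsf{D}_N f$ of $f$ ($N\ge1$) are concave polyhedral functions on the Newton polytope $\mathcal{N}_f$ of $f$ that converge uniformly on $\mathcal{N}_f$ as $N\to\infty$ to a continuous concave limit function $\mathsf{D}_f$ on $\mathcal{N}_f$ (called the decimation limit of $f$). Off $\mathcal{N}_f$ both $\mathsf{D}_N f$ and $\mathsf{D}_f$ are equal to $-\infty$. Furthermore $\mathsf{D}_f=-\mathsf{R}_f^*$, where $\mathsf{R}_f^*$ is the Legendre dual of the Ronkin function $\mathsf{R}_f$ of $f$.
   Context: $\mathbb{C}[\mathbb{Z}^d]$ is identified with the ring of complex Laurent polynomials in $d$ commuting variables: $f(\mathbf{x})=\sum_{\mathbf{n}\in\mathbb{Z}^d}\widehat{f}(\mathbf{n})\mathbf{x}^{\mathbf{n}}$, where $\mathbf{x}^{\mathbf{n}}=x_1^{n_1}\cdots x_d^{n_d}$ and $\widehat{f}(\mathbf{n})\ne 0$ for only finitely many $\mathbf{n}$. The support of $f$ is $\operatorname{supp} f=\{\mathbf{n}:\widehat{f}(\mathbf{n})\neq0\}$, and the Newton polytope $\mathcal{N}_f$ is the convex hull of $\operatorname{supp} f$ in $\mathbb{R}^d$. The coefficient function $\widehat f$ is extended from $\mathbb{Z}^d$ to $\mathbb{R}^d$ by setting it equal to $0$ off $\operatorname{supp} f$. For $N\ge1$ the $N$th decimation of $f$ is $$f_{\langle N\rangle}(x_1,\dots,x_d)=\prod_{k_1=0}^{N-1}\cdots\prod_{k_d=0}^{N-1}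 f(e^{2\pi i k_1/N}x_1,\dots,e^{2\pi i k_d/N}x_d).$$ Let $\underline{\mathbb{R}}=\mathbb{R}\cup\{-\infty\}$ with $\log 0=-\infty$. The $N$th logarithmic rescaling of $f$ is the function $\mathsf{L}_N f\colon\mathbb{R}^d\to\underline{\mathbb{R}}$ given by $(\mathsf{L}_N f)(\mathbf{r})=\frac{1}{N^d}\log|\widehat{f_{\langle N\rangle}}(N^d\mathbf{r})|$. The $N$th renormalized decimation $\mathsf{D}_N f\colon\mathbb{R}^d\to\underline{\mathbb{R}}$ is the concave hull of $\mathsf{L}_N f$, i.e. the pointwise infimum of all affine functions on $\mathbb{R}^d$ that dominate $\mathsf{L}_N f$. The Ronkin function $\mathsf{R}_f\colon\mathbb{R}^d\to\mathbb{R}$ is $$\mathsf{R}_f(u_1,\dots,u_d)=\int_0^1\cdots\int_0^1\log|f(e^{u_1}e^{2\pi i s_1},\dots,e^{u_d}e^{2\pi i s_d})|\,ds_1\cdots ds_d,$$ which is convex, and its Legendre dual is $\mathsf{R}_f^*(\mathbf{r})=\sup\{\langle\mathbf{r},\mathbf{u}\rangle-\mathsf{R}_f(\mathbf{u}):\mathbf{u}\in\mathbb{R}^d\}\in\mathbb{R}\cup\{\infty\}$, with $\langle\cdot,\cdot\rangle$ the usual inner product on $\mathbb{R}^d$. *)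

theory Defs
  imports "HOL-Analysis.Analysis" "HOL-Library.Poly_Mapping"
begin

text \<open>
  The group algebra of \<open>\<int>\<^sup>d\<close> over the complex numbers, i.e. the ring of Laurent polynomials in
  \<open>d = CARD('d)\<close> commuting variables. Finitely supported functions on the additive
  group \<open>int ^ 'd\<close> carry the convolution product, and \<open>Poly_Mapping.lookup f n\<close> is the
  coefficient of \<open>x\<^sup>n\<close>.
\<close>

type_synonym 'd laurent = "(int ^ 'd) \<Rightarrow>\<^sub>0 complex"

definition lmonom :: "complex ^ 'd \<Rightarrow> int ^ 'd \<Rightarrow> complex" where
  "lmonom x n = (\<Prod>i\<in>UNIV. (x $ i) powi (n $ i))"

text \<open>Evaluation is meaningful only at points with nonzero coordinates.\<close>

definition leval :: "'d::finite laurent \<Rightarrow> complex ^ 'd \<Rightarrow> complex" where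
  "leval f x = (\<Sum>n\<in>Poly_Mapping.keys f. Poly_Mapping.lookup f n * lmonom x n)"

definition real_vec :: "int ^ 'd \<Rightarrow> real ^ 'd" where
  "real_vec n = (\<chi> i. real_of_int (n $ i))"

definition newton_polytope :: "'d::finite laurent \<Rightarrow> (real ^ 'd) set" where
  "newton_polytope f = convex hull (real_vec ` Poly_Mapping.keys f)"

text \<open>The coefficient function, extended by zero to all of \<open>\<real>\<^sup>d\<close>.\<close>

definition coeff_ext :: "'d::finite laurent \<Rightarrow> real ^ 'd \<Rightarrow> complex" where
  "coeff_ext f r =
     (if \<forall>i. r $ i \<in> \<int> then Poly_Mapping.lookup f (\<chi> i. \<lfloor>r $ i\<rfloor>) else 0)"

text \<open>
  The Laurent polynomial \<open>f (z\<^sub>1 x\<^sub>1, \<dots>, z\<^sub>d x\<^sub>d)\<close> in the variables \<open>x\<close>: the coefficient at \<open>n\<close> is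
  multiplied by \<open>z\<^sup>n\<close>.
\<close>

definition rescale_vars :: "complex ^ 'd \<Rightarrow> 'd::finite laurent \<Rightarrow> 'd laurent" where
  "rescale_vars z f = Poly_Mapping.mapp (\<lambda>n c. lmonom z n * c) f"

definition torsion_point :: "nat \<Rightarrow> nat ^ 'd \<Rightarrow> complex ^ 'd" where
  "torsion_point N k = (\<chi> i. exp (2 * of_real pi * \<i> * of_nat (k $ i) / of_nat N))"

definition decimation :: "nat \<Rightarrow> 'd::finite laurent \<Rightarrow> 'd laurent" where
  "decimation N f =
     (\<Prod>k\<in>{k :: nat ^ 'd. \<forall>i. k $ i < N}. rescale_vars (torsion_point N k) f)"

text \<open>The values in \<open>\<real> \<union> {-\<infinity>}\<close> are represented in \<^typ>\<open>ereal\<close>.\<close>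

definition log_ext :: "real \<Rightarrow> ereal" where
  "log_ext x = (if x = 0 then -\<infinity> else ereal (ln x))"

definition log_rescaling :: "nat \<Rightarrow> 'd::finite laurent \<Rightarrow> real ^ 'd \<Rightarrow> ereal" where
  "log_rescaling N f r =
     ereal (1 / real N ^ CARD('d)) *
       log_ext (cmod (coeff_ext (decimation N f) (real N ^ CARD('d) *\<^sub>R r)))"

definition concave_hull :: "(real ^ 'd \<Rightarrow> ereal) \<Rightarrow> real ^ 'd \<Rightarrow> ereal" where
  "concave_hull g r =
     Inf {ereal (a \<bullet> r + b) | a b. \<forall>s. g s \<le> ereal (a \<bullet> s + b)}"

definition renormalized_decimation ::
    "nat \<Rightarrow> 'd::finite laurent \<Rightarrow> real ^ 'd \<Rightarrow> ereal" where
  "renormalized_decimation N f = concave_hull (log_rescaling N f)"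

text \<open>
  The iterated integral over \<open>[0,1]\<close> in each variable is taken as the Lebesgue integral over the
  unit cube. For nonzero \<open>f\<close> the integrand is logarithmically singular only on a null
  set, where the convention \<open>ln 0 = 0\<close> has no effect.
\<close>

definition ronkin :: "'d::finite laurent \<Rightarrow> real ^ 'd \<Rightarrow> real" where
  "ronkin f u =
     (LINT s:cbox 0 1|lborel.
        ln (cmod (leval f (\<chi> i. of_real (exp (u $ i)) * exp (2 * of_real pi * \<i> * of_real (s $ i))))))"

definition legendre_dual :: "(real ^ 'd \<Rightarrow> real) \<Rightarrow> real ^ 'd \<Rightarrow> ereal" where
  "legendre_dual R r = (SUP u. ereal (r \<bullet> u - R u))"

text \<open>A concave function is polyhedral if its hypograph is a polyhedron.\<close>

definition concave_polyhedral_on :: "(real ^ 'd) set \<Rightarrow> (real ^ 'd \<Rightarrow> real) \<Rightarrow> bool" where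
  "concave_polyhedral_on S g \<longleftrightarrow>
     concave_on S g \<and> polyhedron {(r, t :: real). r \<in> S \<and> t \<le> g r}"


subsection \<open>Consistency of the polynomial and the pointwise readings of decimation\<close>

lemma finite_decimation_index: "finite {k :: nat ^ 'd::finite. \<forall>i. k $ i < N}"
proof -
  have "{k :: nat ^ 'd. \<forall>i. k $ i < N} \<subseteq> (\<lambda>g. \<chi> i. g i) ` PiE UNIV (\<lambda>_. {..<N})"
  proof
    fix k :: "nat ^ 'd" assume "k \<in> {k. \<forall>i. k $ i < N}"
    then show "k \<in> (\<lambda>g. \<chi> i. g i) ` PiE UNIV (\<lambda>_. {..<N})"
      by (intro image_eqI[where x = "\<lambda>i. k $ i"]) (auto simp: vec_eq_iff)
  qed
  then show ?thesis
    by (rule finite_subset) (intro finite_imageI finite_PiE, auto)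
qed

lemma coeff_ext_real_vec: "coeff_ext f (real_vec n) = Poly_Mapping.lookup f n"
  by (simp add: coeff_ext_def real_vec_def)

lemma lmonom_add:
  assumes "\<forall>i. x $ i \<noteq> 0"
  shows "lmonom x (m + n) = lmonom x m * lmonom x n"
  using assms by (simp add: lmonom_def power_int_add prod.distrib)

lemma lmonom_mult: "lmonom (\<chi> i. z $ i * x $ i) n = lmonom z n * lmonom x n"
  by (simp add: lmonom_def power_int_mult_distrib prod.distrib)

lemma leval_superset:
  assumes "finite A" "Poly_Mapping.keys f \<subseteq> A"
  shows "leval f x = (\<Sum>n\<in>A. Poly_Mapping.lookup f n * lmonom x n)"
  unfolding leval_def using assms
  by (intro sum.mono_neutral_left) (auto simp: in_keys_iff)

lemma leval_add: "leval (f + g) x = leval f x + leval g x"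
proof -
  let ?A = "Poly_Mapping.keys f \<union> Poly_Mapping.keys g"
  have "Poly_Mapping.keys (f + g) \<subseteq> ?A"
    by (rule Poly_Mapping.keys_add)
  then show ?thesis
    by (simp add: leval_superset[of ?A] lookup_add distrib_right sum.distrib)
qed

lemma leval_single: "leval (Poly_Mapping.single n c) x = c * lmonom x n"
  by (simp add: leval_def)

lemma leval_one: "leval 1 x = 1"
  by (simp add: leval_single lmonom_def flip: single_one)

lemma leval_sum: "finite A \<Longrightarrow> leval (sum g A) x = (\<Sum>a\<in>A. leval (g a) x)"
  by (induction A rule: finite_induct) (simp_all add: leval_add leval_def[of 0])

lemma laurent_sum_single:
  "f = (\<Sum>n\<in>Poly_Mapping.keys f. Poly_Mapping.single n (Poly_Mapping.lookup f n))"
  by (rule poly_mapping_eqI)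
     (simp add: lookup_sum lookup_single when_def sum.delta in_keys_iff)

lemma leval_mult:
  assumes "\<forall>i. x $ i \<noteq> 0"
  shows "leval (f * g) x = leval f x * leval g x"
proof -
  have "f * g = (\<Sum>m\<in>Poly_Mapping.keys f. \<Sum>n\<in>Poly_Mapping.keys g.
      Poly_Mapping.single (m + n) (Poly_Mapping.lookup f m * Poly_Mapping.lookup g n))"
    by (subst (1) laurent_sum_single[of f], subst (1) laurent_sum_single[of g])
       (simp add: sum_product mult_single)
  then have "leval (f * g) x = (\<Sum>m\<in>Poly_Mapping.keys f. \<Sum>n\<in>Poly_Mapping.keys g.
      Poly_Mapping.lookup f m * Poly_Mapping.lookup g n * lmonom x (m + n))"
    by (simp add: leval_sum leval_single)
  then show ?thesis
    by (simp add: lmonom_add[OF assms] leval_def[of f] leval_def[of g] sum_product mult_ac)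
qed

lemma leval_prod:
  assumes "\<forall>i. x $ i \<noteq> 0"
  shows "leval (prod g A) x = (\<Prod>a\<in>A. leval (g a) x)"
  by (induction A rule: infinite_finite_induct) (simp_all add: leval_one leval_mult[OF assms])

lemma leval_rescale_vars:
  "leval (rescale_vars z f) x = leval f (\<chi> i. z $ i * x $ i)"
proof -
  have "Poly_Mapping.keys (rescale_vars z f) \<subseteq> Poly_Mapping.keys f"
    by (simp add: rescale_vars_def keys_mapp_subset)
  then show ?thesis
    by (simp add: leval_superset[of "Poly_Mapping.keys f"] lmonom_mult rescale_vars_def
        lookup_mapp when_def mult_ac)
qed

lemma leval_decimation:
  assumes "\<forall>i. x $ i \<noteq> 0"
  shows "leval (decimation N f) x =
    (\<Prod>k\<in>{k. \<forall>i. k $ i < N}.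
       leval f (\<chi> i. exp (2 * of_real pi * \<i> * of_nat (k $ i) / of_nat N) * x $ i))"
  by (simp add: decimation_def leval_prod[OF assms] leval_rescale_vars torsion_point_def)

end

theory Submission
  imports Defs "HOL-Probability.Probability" "HOL-Real_Asymp.Real_Asymp"
    "HOL-Computational_Algebra.Fundamental_Theorem_Algebra"
begin

text \<open>
  Both sides of the asserted convergence are concave conjugates, that is, functions of the form
  \<open>r \<mapsto> INF u. h u - r \<bullet> u\<close>. For \<open>- R\<^sub>f\<^sup>*\<close> the function \<open>h\<close> is the Ronkin function \<open>R\<^sub>f\<close>. For the
  \<open>N\<close>th renormalized decimation it is \<open>h\<^sub>N u = N\<^sup>-\<^sup>d max\<^sub>n (log |F\<^sub>N(n)| + n \<bullet> u)\<close>, the maximum being taken over the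
  support of the decimation, whose coefficients are written \<open>F\<^sub>N(n)\<close>
  (\<open>renormalized_decimation_eq_neg_legendre_dual\<close>). Conjugation does not increase uniform distances,
  so the heart of the matter is the estimate \<open>|h\<^sub>N - R\<^sub>f| \<le> \<epsilon>\<^sub>N\<close>, uniform in \<open>u\<close>, with \<open>\<epsilon>\<^sub>N \<longlonglongrightarrow> 0\<close>
  (\<open>log_height_decimation_bounds\<close>).

  Since the Haar measure of the torus is invariant under rotations, the Ronkin function of the
  decimation is \<open>N\<^sup>d R\<^sub>f\<close>. On the one hand, a Laurent polynomial is at most the number of its terms
  times its largest term, and the decimation has only polynomially many terms in \<open>N\<close>; this bounds
  \<open>R\<^sub>f\<close> by \<open>h\<^sub>N\<close> up to \<open>O(log N / N\<^sup>d)\<close>. On the other hand, a coefficient of a polynomial of degree at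
  most \<open>m\<close> in each of \<open>d\<close> variables is at most \<open>2\<^sup>d\<^sup>m\<close> times the Mahler measure. The decimation itself has
  degree of order \<open>N\<^sup>d\<close>, for which this would be useless; but it is invariant under multiplication of
  any variable by an \<open>N\<close>th root of unity, so it is a Laurent polynomial in the \<open>N\<close>th powers of the
  variables, of degree only \<open>O(N\<^sup>d\<^sup>-\<^sup>1)\<close> in these. After division by \<open>N\<^sup>d\<close> the error is \<open>O(1 / N)\<close>.

  The coefficient inequality (\<open>torus_deficit\<close>) is deduced in one variable from a factorization into
  linear factors and Jensen's inequality for each factor, and carried to several variables by Tonelli's
  theorem. It is stated for the nonnegative quantity \<open>log (K / |z|)\<close> with values in \<open>[0, \<infinity>]\<close>, where
  \<open>K\<close> bounds \<open>|z|\<close>. No integrability is presupposed in this form; on the contrary, the inequality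
  shows that a nonzero Laurent polynomial vanishes only on a null set of the torus and that the logarithm of its
  modulus is integrable.

  The qualitative statements come for free. A renormalized decimation is the concave hull of finitely many
  points, hence a minimum of finitely many affine functions on the convex hull of these points
  (\<open>neg_legendre_dual_Max_eq_finite_min\<close>) and \<open>-\<infinity>\<close> elsewhere. All the renormalized
  decimations and \<open>- R\<^sub>f\<^sup>*\<close> are within bounded distance of each other, so they are finite on the
  same set, which for \<open>N = 1\<close> is the Newton polytope.
\<close>

section \<open>The uniform measure on the torus\<close>

text \<open>
  The circle is parametrized by \<open>[0, 1]\<close>, and the torus \<open>(S\<^sup>1)\<^sup>I\<close> by a product of copies of this measure.
  Products over finite subsets of the index type are what the induction on the number of variables
  needs.
\<close>

definition unit_measure :: "real measure" where
  "unit_measure = density lborel (indicator {0..1})"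

lemma sets_unit_measure [simp, measurable_cong]: "sets unit_measure = sets borel"
  and space_unit_measure [simp]: "space unit_measure = UNIV"
  by (simp_all add: unit_measure_def)

lemma nn_integral_unit_measure:
  assumes [measurable]: "g \<in> borel_measurable borel"
  shows "(\<integral>\<^sup>+t. g t \<partial>unit_measure) = (\<integral>\<^sup>+t. indicator {0..1} t * g t \<partial>lborel)"
  unfolding unit_measure_def by (subst nn_integral_density) auto

lemma emeasure_unit_measure:
  assumes [measurable]: "A \<in> sets borel"
  shows "emeasure unit_measure A = emeasure lborel ({0..1} \<inter> A)"
  unfolding unit_measure_def by (subst emeasure_density)
    (auto simp flip: nn_integral_indicator simp: indicator_inter_arith intro!: nn_integral_cong)

lemma prob_space_unit_measure: "prob_space unit_measure"
  by (rule prob_spaceI) (simp add: emeasure_unit_measure)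

interpretation unit_measure: prob_space unit_measure
  by (rule prob_space_unit_measure)

interpretation torus: product_prob_space "\<lambda>_ :: 'd. unit_measure" UNIV
  by (intro product_prob_spaceI prob_space_unit_measure)

text \<open>
  Rotation invariance of the circle. For \<open>c = frac a\<close>, adding \<open>a\<close> modulo 1 translates \<open>[0, 1 - c)\<close> onto \<open>[c, 1)\<close>
  and \<open>[1 - c, 1)\<close> onto \<open>[0, c)\<close>; the end point 1 is a null set.
\<close>

lemma distr_unit_measure_frac:
  "distr unit_measure borel (\<lambda>t. frac (t + a)) = unit_measure"
proof (rule measure_eqI)
  fix A :: "real set" assume "A \<in> sets (distr unit_measure borel (\<lambda>t. frac (t + a)))"
  then have [measurable]: "A \<in> sets borel" by simp
  have [measurable]: "(\<lambda>t::real. frac (t + a)) \<in> borel_measurable borel"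
    unfolding frac_def by measurable
  define c where "c = frac a"
  have c: "0 \<le> c" "c < 1" by (simp_all add: c_def frac_lt_1)
  have fr: "frac (t + a) = frac (t + c)" for t
    unfolding c_def by (metis frac_add_simps(2))
  have "emeasure (distr unit_measure borel (\<lambda>t. frac (t + a))) A
      = (\<integral>\<^sup>+t. indicator A (frac (t + a)) \<partial>unit_measure)"
    by (simp add: nn_integral_distr flip: nn_integral_indicator)
  also have "\<dots> = (\<integral>\<^sup>+t. indicator {0..1} t * indicator A (frac (t + a)) \<partial>lborel)"
    by (rule nn_integral_unit_measure) measurable
  also have "\<dots> = (\<integral>\<^sup>+t. indicator ({c..<1} \<inter> A) (c + 1 * t) + indicator ({0..<c} \<inter> A) ((c - 1) + 1 * t) \<partial>lborel)"
  proof (rule nn_integral_cong_AE, rule AE_mp[OF AE_lborel_singleton[of 1]], rule AE_I2, rule impI)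
    fix t :: real assume "t \<noteq> 1"
    consider "t < 0 \<or> t > 1" | "0 \<le> t" "t + c < 1" | "t < 1" "t + c \<ge> 1" using \<open>t \<noteq> 1\<close> by linarith
    then show "indicator {0..1} t * indicator A (frac (t + a))
      = (indicator ({c..<1} \<inter> A) (c + 1 * t) + indicator ({0..<c} \<inter> A) ((c - 1) + 1 * t) :: ennreal)"
    proof cases
      case 2
      then have "frac (t + c) = t + c" using c by (simp add: frac_eq)
      with 2 c show ?thesis by (auto simp: fr indicator_def add.commute[of c])
    next
      case 3
      have "frac (t + c) = frac (t + c - 1)"
        by (metis frac_1_eq diff_add_cancel)
      also have "\<dots> = t + c - 1" using 3 c by (simp add: frac_eq)
      finally have "frac (t + c) = c - 1 + t" by simp
      with 3 c show ?thesis by (auto simp: fr indicator_def)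
    qed (use c in \<open>auto simp: indicator_def\<close>)
  qed
  also have "\<dots> = (\<integral>\<^sup>+t. indicator ({c..<1} \<inter> A) t \<partial>lborel) + (\<integral>\<^sup>+t. indicator ({0..<c} \<inter> A) t \<partial>lborel)"
    using nn_integral_real_affine[of "indicator ({c..<1} \<inter> A)" 1 c]
      nn_integral_real_affine[of "indicator ({0..<c} \<inter> A)" 1 "c - 1"]
    by (subst nn_integral_add) (simp_all del: nn_integral_indicator nn_integral_indicator')
  also have "\<dots> = (\<integral>\<^sup>+t. indicator ({c..<1} \<inter> A) t + indicator ({0..<c} \<inter> A) t \<partial>lborel)"
    by (subst nn_integral_add) auto
  also have "\<dots> = (\<integral>\<^sup>+t. indicator {0..1} t * indicator A t \<partial>lborel)"
    by (rule nn_integral_cong_AE, rule AE_mp[OF AE_lborel_singleton[of 1]], rule AE_I2, rule impI)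
       (use c in \<open>auto simp: indicator_def\<close>)
  also have "\<dots> = emeasure unit_measure A"
    by (subst nn_integral_unit_measure[symmetric]) auto
  finally show "emeasure (distr unit_measure borel (\<lambda>t. frac (t + a))) A = emeasure unit_measure A" .
qed simp

lemma nn_integral_unit_measure_shift:
  assumes [measurable]: "g \<in> borel_measurable borel" and per: "\<And>t. g (frac t) = g t"
  shows "(\<integral>\<^sup>+t. g (t + a) \<partial>unit_measure) = (\<integral>\<^sup>+t. g t \<partial>unit_measure)"
proof -
  have [measurable]: "(\<lambda>t::real. frac (t + a)) \<in> borel_measurable borel"
    unfolding frac_def by measurable
  have "(\<integral>\<^sup>+t. g t \<partial>unit_measure) = (\<integral>\<^sup>+t. g t \<partial>distr unit_measure borel (\<lambda>t. frac (t + a)))"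
    by (simp add: distr_unit_measure_frac)
  also have "\<dots> = (\<integral>\<^sup>+t. g (t + a) \<partial>unit_measure)"
    by (subst nn_integral_distr) (auto simp: per)
  finally show ?thesis by simp
qed

abbreviation torus_measure :: "'d set \<Rightarrow> ('d \<Rightarrow> real) measure" where
  "torus_measure I \<equiv> PiM I (\<lambda>_. unit_measure)"

lemma distr_torus_frac:
  fixes a :: "'d::finite \<Rightarrow> real"
  shows "distr (torus_measure UNIV) (torus_measure UNIV) (\<lambda>s i. frac (s i + a i)) = torus_measure UNIV"
proof (rule torus.PiM_eqI)
  have fr [measurable]: "(\<lambda>t::real. frac (t + a i)) \<in> borel_measurable borel" for i
    unfolding frac_def by measurable
  have "(\<lambda>s. \<lambda>i\<in>UNIV. frac (s i + a i)) \<in> torus_measure UNIV \<rightarrow>\<^sub>M torus_measure UNIV"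
    by (intro measurable_restrict measurable_compose[OF measurable_component_singleton]) simp_all
  then have [measurable]: "(\<lambda>s i. frac (s i + a i)) \<in> torus_measure UNIV \<rightarrow>\<^sub>M torus_measure UNIV"
    by (subst (asm) restrict_UNIV)
  fix A :: "'d \<Rightarrow> real set" assume "\<And>i. i \<in> UNIV \<Longrightarrow> A i \<in> sets unit_measure"
  then have A[measurable]: "A i \<in> sets borel" for i by simp
  have "emeasure (distr (torus_measure UNIV) (torus_measure UNIV) (\<lambda>s i. frac (s i + a i))) (Pi\<^sub>E UNIV A)
    = emeasure (torus_measure UNIV) ((\<lambda>s i. frac (s i + a i)) -` Pi\<^sub>E UNIV A \<inter> space (torus_measure UNIV))"
    by (rule emeasure_distr) (auto intro!: sets_PiM_I_finite)
  also have "(\<lambda>s i. frac (s i + a i)) -` Pi\<^sub>E UNIV A \<inter> space (torus_measure UNIV)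
    = Pi\<^sub>E UNIV (\<lambda>i. (\<lambda>t. frac (t + a i)) -` A i)"
    by (auto simp: space_PiM PiE_iff)
  also have "emeasure (torus_measure UNIV) \<dots> = (\<Prod>i\<in>UNIV. emeasure unit_measure ((\<lambda>t. frac (t + a i)) -` A i))"
    by (subst torus.emeasure_PiM) (auto intro!: measurable_sets_borel[OF fr A])
  also have "\<dots> = (\<Prod>i\<in>UNIV. emeasure unit_measure (A i))"
  proof (rule prod.cong)
    fix i
    have "emeasure unit_measure (A i) = emeasure (distr unit_measure borel (\<lambda>t. frac (t + a i))) (A i)"
      by (simp add: distr_unit_measure_frac)
    also have "\<dots> = emeasure unit_measure ((\<lambda>t. frac (t + a i)) -` A i)"
      by (subst emeasure_distr) auto
    finally show "emeasure unit_measure ((\<lambda>t. frac (t + a i)) -` A i) = emeasure unit_measure (A i)" ..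
  qed simp
  finally show "emeasure (distr (torus_measure UNIV) (torus_measure UNIV) (\<lambda>s i. frac (s i + a i))) (Pi\<^sub>E UNIV A)
    = (\<Prod>i\<in>UNIV. emeasure unit_measure (A i))" .
qed simp_all

text \<open>
  Lebesgue measure on vectors as a product measure indexed by the coordinates rather than by
  basis vectors.
\<close>

lemma lborel_vec_eq_distr_PiM:
  "(lborel :: (real ^ 'd::finite) measure) = distr (PiM UNIV (\<lambda>_. lborel)) borel (\<lambda>s. \<chi> i. s i)"
proof (rule lborel_eqI)
  interpret product_sigma_finite "\<lambda>_::'d. lborel :: real measure" by standard
  have [measurable]: "(\<lambda>s. \<chi> i. s i) \<in> borel_measurable (PiM UNIV (\<lambda>_::'d. lborel :: real measure))"
    by (subst borel_measurable_euclidean_space) (auto simp: Basis_vec_def inner_axis)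
  fix l u :: "real ^ 'd" assume lu: "\<And>b. b \<in> Basis \<Longrightarrow> l \<bullet> b \<le> u \<bullet> b"
  have lu': "l $ i \<le> u $ i" for i
    using lu[of "axis i 1"] by (simp add: inner_axis axis_in_Basis_iff)
  have "emeasure (distr (PiM UNIV (\<lambda>_. lborel)) borel (\<lambda>s. \<chi> i. s i)) (box l u)
    = emeasure (PiM UNIV (\<lambda>_. lborel)) ((\<lambda>s. \<chi> i. s i) -` box l u \<inter> space (PiM UNIV (\<lambda>_. lborel)))"
    by (rule emeasure_distr) auto
  also have "(\<lambda>s. \<chi> i. s i) -` box l u \<inter> space (PiM UNIV (\<lambda>_. lborel)) = Pi\<^sub>E UNIV (\<lambda>i. {l $ i <..< u $ i})"
    by (auto simp: space_PiM PiE_iff mem_box_cart)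
  also have "emeasure (PiM UNIV (\<lambda>_. lborel)) \<dots> = (\<Prod>i\<in>UNIV. ennreal (u $ i - l $ i))"
    by (subst emeasure_PiM) (auto simp: lu')
  also have "\<dots> = ennreal (\<Prod>i\<in>UNIV. u $ i - l $ i)"
    by (rule prod_ennreal) (simp add: lu')
  also have "(\<Prod>i\<in>UNIV. u $ i - l $ i) = (\<Prod>b\<in>Basis. (u - l) \<bullet> b)"
    by (simp add: Basis_vec_def inner_axis prod.UNION_disjoint UNION_singleton_eq_range prod.reindex inj_on_def axis_eq_axis)
  finally show "emeasure (distr (PiM UNIV (\<lambda>_. lborel)) borel (\<lambda>s. \<chi> i. s i)) (box l u)
    = ennreal (\<Prod>b\<in>Basis. (u - l) \<bullet> b)" .
qed simp

section \<open>The logarithmic deficit and Jensen's inequality\<close>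

text \<open>
  The amount by which \<open>log |z|\<close> falls short of an upper bound \<open>log K\<close>. Working with this
  nonnegative extended quantity instead of \<open>log |z|\<close> makes Tonelli's theorem and Fatou's lemma applicable
  without integrability hypotheses, and zeros of \<open>z\<close> need no separate treatment.
\<close>

definition log_deficit :: "real \<Rightarrow> complex \<Rightarrow> ennreal" where
  "log_deficit K z = (if z = 0 then \<top> else ennreal (ln (K / cmod z)))"

lemma measurable_log_deficit [measurable]: "log_deficit K \<in> borel_measurable borel"
  unfolding log_deficit_def by measurable

lemma log_deficit_0 [simp]: "log_deficit K 0 = \<top>"
  by (simp add: log_deficit_def)

lemma log_deficit_cong: "cmod z = cmod w \<Longrightarrow> log_deficit K z = log_deficit K w"
  by (auto simp: log_deficit_def)

lemma log_deficit_mult: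
  assumes "0 < K" "0 < L" "cmod z \<le> K" "cmod w \<le> L"
  shows "log_deficit (K * L) (z * w) = log_deficit K z + log_deficit L w"
proof (cases "z = 0 \<or> w = 0")
  case False
  then have "ln (K * L / cmod (z * w)) = ln (K / cmod z) + ln (L / cmod w)"
    using assms by (simp add: norm_mult ln_mult ln_div)
  moreover have "ln (K / cmod z) \<ge> 0" "ln (L / cmod w) \<ge> 0"
    using False assms by (auto intro!: ln_ge_zero simp: field_simps)
  ultimately show ?thesis using False by (simp add: log_deficit_def ennreal_plus)
qed auto

lemma log_deficit_mono: "0 < K \<Longrightarrow> K \<le> L \<Longrightarrow> log_deficit K z \<le> log_deficit L z"
  by (auto simp: log_deficit_def intro!: ennreal_leI divide_right_mono)

lemma log_deficit_antimono: "0 < K \<Longrightarrow> cmod z \<le> cmod w \<Longrightarrow> log_deficit K w \<le> log_deficit K z"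
  by (auto simp: log_deficit_def intro!: ennreal_leI divide_left_mono)

lemma log_deficit_scale:
  assumes "0 < K" "K \<le> L" "cmod z \<le> K"
  shows "log_deficit L z = log_deficit K z + ennreal (ln (L / K))"
  using log_deficit_mult[of K "L / K" z 1] assms by (simp add: log_deficit_def)

text \<open>
  Continuity, including at \<open>z = 0\<close>; it feeds Fatou's lemma in \<open>jensen_closed\<close>.
\<close>

lemma tendsto_log_deficit:
  assumes "0 < K" "x \<longlonglongrightarrow> z"
  shows "(\<lambda>n. log_deficit K (x n)) \<longlonglongrightarrow> log_deficit K z"
proof (cases "z = 0")
  case False
  then have ev: "eventually (\<lambda>n. x n \<noteq> 0) sequentially"
    using assms(2) by (simp add: tendsto_imp_eventually_ne)
  have "(\<lambda>n. ennreal (ln (K / cmod (x n)))) \<longlonglongrightarrow> ennreal (ln (K / cmod z))"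
    using assms False by (intro tendsto_intros) auto
  moreover have "log_deficit K z = ennreal (ln (K / cmod z))"
    using False by (simp add: log_deficit_def)
  ultimately show ?thesis
    by (elim Lim_transform_eventually ssubst) (use ev in \<open>auto simp: log_deficit_def elim!: eventually_mono\<close>)
next
  case True
  have "eventually (\<lambda>n. log_deficit K (x n) \<ge> ennreal M) sequentially" for M
  proof -
    have "eventually (\<lambda>n. cmod (x n) < K / exp M) sequentially"
      using assms True by (intro order_tendstoD(2)[OF tendsto_norm[OF assms(2)]]) auto
    then show ?thesis
    proof eventually_elim
      case (elim n)
      then show ?case using assms(1)
        by (auto simp: log_deficit_def field_simps ln_ge_iff intro!: ennreal_leI)
    qed
  qed
  note ev = this
  have "(\<lambda>n. log_deficit K (x n)) \<longlonglongrightarrow> \<top>"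
    unfolding tendsto_top_iff_ennreal
  proof (intro allI impI)
    fix l :: real assume "0 \<le> l"
    show "eventually (\<lambda>n. ennreal l < log_deficit K (x n)) sequentially"
      using ev[of "l + 1"]
    proof eventually_elim
      case (elim n)
      have "ennreal l < ennreal (l + 1)" using \<open>0 \<le> l\<close> by (intro ennreal_lessI) auto
      then show ?case using elim by (rule less_le_trans)
    qed
  qed
  then show ?thesis using True by simp
qed

text \<open>
  The point of the unit circle with angle \<open>t\<close>, measured in full turns.
\<close>

definition circ :: "real \<Rightarrow> complex" where "circ t = cis (2 * pi * t)"

lemma norm_circ [simp]: "cmod (circ t) = 1"
  and circ_nonzero [simp]: "circ t \<noteq> 0"
  by (simp_all add: circ_def)

lemma circ_add: "circ (s + t) = circ s * circ t"
  by (simp add: circ_def cis_mult distrib_left)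

lemma circ_int [simp]: "circ (of_int k) = 1"
  by (simp add: circ_def cis_multiple_2pi)

lemma circ_frac [simp]: "circ (frac t) = circ t"
proof -
  show ?thesis
    using circ_add[of "of_int \<lfloor>t\<rfloor>" "frac t"] by (simp add: frac_def)
qed

lemma measurable_circ [measurable]: "circ \<in> borel_measurable borel"
  unfolding circ_def by (intro borel_measurable_continuous_onI continuous_intros)

lemma circ_power: "circ t ^ n = circ (real n * t)"
  by (simp only: circ_def Complex.DeMoivre) (simp add: mult_ac)

text \<open>
  Rotation by half of the period of \<open>z\<^sup>N\<close> turns \<open>1 - \<beta>z\<^sup>N\<close> into \<open>1 + \<beta>z\<^sup>N\<close>, and the product of the two is
  \<open>1 - \<beta>\<^sup>2z\<^sup>2\<^sup>N\<close>. The summand \<open>ln 2\<close> accounts for the bound 2 instead of 4 on the product.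
\<close>

lemma jensen_doubling:
  assumes "cmod \<beta> \<le> 1" "N \<ge> 1"
  shows "2 * (\<integral>\<^sup>+t. log_deficit 2 (1 - \<beta> * circ t ^ N) \<partial>unit_measure)
    = (\<integral>\<^sup>+t. log_deficit 2 (1 - \<beta>\<^sup>2 * circ t ^ (2 * N)) \<partial>unit_measure) + ennreal (ln 2)"
proof -
  let ?J = "\<integral>\<^sup>+t. log_deficit 2 (1 - \<beta> * circ t ^ N) \<partial>unit_measure"
  have shift: "circ (t + 1 / (2 * real N)) ^ N = - (circ t ^ N)" for t
  proof -
    have "real N * (t + 1 / (2 * real N)) = real N * t + 1/2"
      using assms(2) by (simp add: field_simps)
    then have "circ (t + 1 / (2 * real N)) ^ N = circ (real N * t + 1/2)"
      by (simp add: circ_power)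
    also have "\<dots> = - (circ t ^ N)"
      by (simp add: circ_add circ_power) (simp add: circ_def)
    finally show ?thesis .
  qed
  have n: "cmod (\<beta> * circ t ^ N) \<le> 1" for t
    using assms(1) by (simp add: norm_mult norm_power)
  have le2: "cmod (1 - w) \<le> 2" "cmod (1 + w) \<le> 2" if "cmod w \<le> 1" for w
    using norm_triangle_ineq4[of 1 w] norm_triangle_ineq[of 1 w] that by auto
  have "?J = (\<integral>\<^sup>+t. log_deficit 2 (1 - \<beta> * circ (t + 1 / (2 * real N)) ^ N) \<partial>unit_measure)"
    by (rule nn_integral_unit_measure_shift[symmetric, of "\<lambda>t. log_deficit 2 (1 - \<beta> * circ t ^ N)"]) simp_all
  then have "?J + ?J = ?J + (\<integral>\<^sup>+t. log_deficit 2 (1 + \<beta> * circ t ^ N) \<partial>unit_measure)"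
    by (simp add: shift)
  also have "\<dots> = (\<integral>\<^sup>+t. log_deficit 2 (1 - \<beta> * circ t ^ N) + log_deficit 2 (1 + \<beta> * circ t ^ N) \<partial>unit_measure)"
    by (rule nn_integral_add[symmetric]) simp_all
  also have "\<dots> = (\<integral>\<^sup>+t. log_deficit 2 (1 - \<beta>\<^sup>2 * circ t ^ (2 * N)) + ennreal (ln 2) \<partial>unit_measure)"
  proof (rule nn_integral_cong)
    fix t
    let ?w = "\<beta> * circ t ^ N"
    have "log_deficit 2 (1 - ?w) + log_deficit 2 (1 + ?w) = log_deficit (2 * 2) ((1 - ?w) * (1 + ?w))"
      using n le2 by (intro log_deficit_mult[symmetric]) auto
    also have "(1 - ?w) * (1 + ?w) = 1 - \<beta>\<^sup>2 * circ t ^ (2 * N)"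
      by (simp add: algebra_simps power2_eq_square power_mult power_mult_distrib)
    also have "log_deficit (2 * 2) \<dots> = log_deficit 2 \<dots> + ennreal (ln 2)"
      using le2(1)[of "\<beta>\<^sup>2 * circ t ^ (2 * N)"] assms(1)
      by (subst log_deficit_scale[of 2]) (auto simp: norm_mult norm_power power_le_one)
    finally show "log_deficit 2 (1 - ?w) + log_deficit 2 (1 + ?w)
      = log_deficit 2 (1 - \<beta>\<^sup>2 * circ t ^ (2 * N)) + ennreal (ln 2)" .
  qed
  also have "\<dots> = (\<integral>\<^sup>+t. log_deficit 2 (1 - \<beta>\<^sup>2 * circ t ^ (2 * N)) \<partial>unit_measure) + ennreal (ln 2)"
    by (subst nn_integral_add) (simp_all add: unit_measure.emeasure_space_1[simplified])
  finally show ?thesis by (simp add: mult_2)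
qed

text \<open>
  Equivalently, \<open>log |1 - \<beta>z\<^sup>N|\<close> has nonnegative mean. Each application of \<open>jensen_doubling\<close> halves the
  difference between the mean deficit and \<open>ln 2\<close>, while \<open>|1 - \<beta>z\<^sup>N| \<ge> 1 - |\<beta>|\<close> bounds that difference throughout.
\<close>

lemma jensen_interior:
  assumes "cmod \<beta> < 1" "N \<ge> 1"
  shows "(\<integral>\<^sup>+t. log_deficit 2 (1 - \<beta> * circ t ^ N) \<partial>unit_measure) \<le> ennreal (ln 2)"
proof -
  define r where "r = cmod \<beta>"
  define C where "C = - ln (1 - r)"
  have r: "0 \<le> r" "r < 1" using assms by (auto simp: r_def)
  have C: "C \<ge> 0" using r by (simp add: C_def)
  have *: "(\<integral>\<^sup>+t. log_deficit 2 (1 - b * circ t ^ M) \<partial>unit_measure) \<le> ennreal (ln 2 + C / 2 ^ j)"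
    if "cmod b \<le> r" "M \<ge> 1" for b M j
    using that
  proof (induction j arbitrary: b M)
    case 0
    have "log_deficit 2 (1 - b * circ t ^ M) \<le> ennreal (ln 2 + C)" for t
    proof -
      have nr: "cmod (of_real (1 - r)) = 1 - r"
        using r by (simp only: norm_of_real)
      have "cmod (b * circ t ^ M) \<le> r"
        using 0 by (simp add: norm_mult norm_power)
      then have "cmod (of_real (1 - r)) \<le> cmod (1 - b * circ t ^ M)"
        using norm_triangle_ineq2[of 1 "b * circ t ^ M"] unfolding nr by simp
      then have "log_deficit 2 (1 - b * circ t ^ M) \<le> log_deficit 2 (of_real (1 - r))"
        by (intro log_deficit_antimono) simp_all
      also have "\<dots> = ennreal (ln 2 + C)"
        using r nr unfolding log_deficit_def by (auto simp: ln_div C_def)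
      finally show ?thesis .
    qed
    then have "(\<integral>\<^sup>+t. log_deficit 2 (1 - b * circ t ^ M) \<partial>unit_measure) \<le> (\<integral>\<^sup>+t. ennreal (ln 2 + C) \<partial>unit_measure)"
      by (intro nn_integral_mono)
    then show ?case by (simp add: unit_measure.emeasure_space_1[simplified])
  next
    case (Suc j)
    let ?J = "\<integral>\<^sup>+t. log_deficit 2 (1 - b * circ t ^ M) \<partial>unit_measure"
    have "(cmod b)\<^sup>2 \<le> cmod b"
      using Suc.prems r by (simp add: power2_eq_square mult_left_le)
    then have "2 * ?J \<le> ennreal (ln 2 + C / 2 ^ j) + ennreal (ln 2)"
      using Suc.prems r Suc.IH[of "b\<^sup>2" "2 * M"] by (subst jensen_doubling) (auto simp: norm_power intro!: add_right_mono)
    also have "\<dots> = ennreal (ln 2 + C / 2 ^ j + ln 2)"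
      using C by (intro ennreal_plus[symmetric]) auto
    also have "ln 2 + C / 2 ^ j + ln 2 = 2 * (ln 2 + C / 2 ^ Suc j)"
      by (simp add: field_simps)
    also have "ennreal \<dots> = 2 * ennreal (ln 2 + C / 2 ^ Suc j)"
      using C by (subst ennreal_mult) auto
    finally show ?case
      by (subst (asm) ennreal_mult_le_mult_iff) auto
  qed
  have "(\<lambda>j. ennreal (ln 2 + C / 2 ^ j)) \<longlonglongrightarrow> ennreal (ln 2 + 0)"
  proof (intro tendsto_intros)
    show "(\<lambda>j. C / 2 ^ j) \<longlonglongrightarrow> 0" by (rule LIMSEQ_divide_realpow_zero) simp
  qed
  then show ?thesis
    using *[of \<beta> N] assms by (intro LIMSEQ_le_const[of _ "ennreal (ln 2)"]) (auto simp: r_def)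
qed

text \<open>
  The boundary case \<open>|\<beta>| = 1\<close>, where the logarithm is singular, follows from Fatou's lemma along \<open>x\<^sub>n\<beta>\<close> with
  \<open>x\<^sub>n\<close> increasing to 1.
\<close>

lemma jensen_closed:
  assumes "cmod \<beta> \<le> 1" "N \<ge> 1"
  shows "(\<integral>\<^sup>+t. log_deficit 2 (1 - \<beta> * circ t ^ N) \<partial>unit_measure) \<le> ennreal (ln 2)"
proof -
  define x where "x n = (1 - 1 / real (Suc n))" for n
  have x: "x \<longlonglongrightarrow> 1"
    unfolding x_def using tendsto_diff[OF tendsto_const LIMSEQ_inverse_real_of_nat, of 1]
    by (simp add: inverse_eq_divide)
  have "(\<integral>\<^sup>+t. log_deficit 2 (1 - \<beta> * circ t ^ N) \<partial>unit_measure)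
    = (\<integral>\<^sup>+t. liminf (\<lambda>n. log_deficit 2 (1 - (of_real (x n) * \<beta>) * circ t ^ N)) \<partial>unit_measure)"
  proof (rule nn_integral_cong)
    fix t
    have "(\<lambda>n. 1 - (of_real (x n) * \<beta>) * circ t ^ N) \<longlonglongrightarrow> 1 - (of_real 1 * \<beta>) * circ t ^ N"
      by (intro tendsto_intros x)
    then have "(\<lambda>n. log_deficit 2 (1 - (of_real (x n) * \<beta>) * circ t ^ N)) \<longlonglongrightarrow> log_deficit 2 (1 - \<beta> * circ t ^ N)"
      by (intro tendsto_log_deficit) auto
    then show "log_deficit 2 (1 - \<beta> * circ t ^ N) = liminf (\<lambda>n. log_deficit 2 (1 - (of_real (x n) * \<beta>) * circ t ^ N))"
      using lim_imp_Liminf sequentially_bot by metis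
  qed
  also have "\<dots> \<le> liminf (\<lambda>n. \<integral>\<^sup>+t. log_deficit 2 (1 - (of_real (x n) * \<beta>) * circ t ^ N) \<partial>unit_measure)"
    by (rule nn_integral_liminf) simp
  also have "\<dots> \<le> liminf (\<lambda>n. ennreal (ln 2))"
  proof (intro Liminf_mono always_eventually allI jensen_interior)
    fix n
    have "\<bar>x n\<bar> < 1" by (auto simp: x_def)
    then show "cmod (of_real (x n) * \<beta>) < 1"
      using assms(1) by (simp add: norm_mult) (metis abs_ge_zero mult_left_le order_le_less_trans)
  qed (use assms in auto)
  also have "\<dots> = ennreal (ln 2)" by (simp add: Liminf_const)
  finally show ?thesis .
qed

text \<open>
  This says that the mean of \<open>log |z\<^sup>N - \<alpha>|\<close> is at least \<open>log (max 1 |\<alpha>|)\<close>. On the circle \<open>|z\<^sup>N - \<alpha>|\<close>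
  equals \<open>|1 - \<beta>z\<^sup>N|\<close> for the complex conjugate \<open>\<beta>\<close> of \<open>\<alpha>\<close>, and it is \<open>|\<alpha>| |1 - \<beta>z\<^sup>N|\<close> for \<open>\<beta> = 1 / \<alpha>\<close>; one of
  the two has \<open>|\<beta>| \<le> 1\<close>.
\<close>

lemma linear_factor_deficit:
  assumes "N \<ge> 1"
  shows "(\<integral>\<^sup>+t. log_deficit (2 * max 1 (cmod \<alpha>)) (circ t ^ N - \<alpha>) \<partial>unit_measure) \<le> ennreal (ln 2)"
proof (cases "cmod \<alpha> \<le> 1")
  case True
  have "cmod (circ t ^ N - \<alpha>) = cmod (1 - cnj \<alpha> * circ t ^ N)" for t
  proof -
    have u: "circ t ^ N * cnj (circ t ^ N) = 1"
      by (simp add: complex_norm_square[symmetric] norm_power del: complex_cnj_power)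
    have "1 - cnj \<alpha> * circ t ^ N = circ t ^ N * cnj (circ t ^ N - \<alpha>)"
      using u by (simp add: algebra_simps)
    then show ?thesis by (simp add: norm_mult norm_power del: complex_cnj_diff)
  qed
  then show ?thesis
    using jensen_closed[of "cnj \<alpha>" N] assms True
    by (simp add: max_absorb1 log_deficit_cong[of "circ _ ^ N - \<alpha>" "1 - cnj \<alpha> * circ _ ^ N"])
next
  case False
  have "log_deficit (2 * max 1 (cmod \<alpha>)) (circ t ^ N - \<alpha>) = log_deficit 2 (1 - inverse \<alpha> * circ t ^ N)" for t
  proof -
    have 1: "circ t ^ N - \<alpha> = (1 - inverse \<alpha> * circ t ^ N) * (- \<alpha>)"
      using False by (auto simp: field_simps)
    have "cmod (1 - inverse \<alpha> * circ t ^ N) \<le> 1 + cmod (inverse \<alpha> * circ t ^ N)"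
      using norm_triangle_ineq4[of 1 "inverse \<alpha> * circ t ^ N"] by simp
    also have "\<dots> \<le> 2" using False by (simp add: norm_mult norm_power norm_inverse inverse_le_1_iff)
    finally have "log_deficit (2 * cmod \<alpha>) (circ t ^ N - \<alpha>)
      = log_deficit 2 (1 - inverse \<alpha> * circ t ^ N) + log_deficit (cmod \<alpha>) (- \<alpha>)"
      unfolding 1 using False by (intro log_deficit_mult) auto
    also have "log_deficit (cmod \<alpha>) (- \<alpha>) = 0" using False by (auto simp: log_deficit_def)
    finally show ?thesis using False by (simp add: max_absorb2)
  qed
  then show ?thesis
    using jensen_closed[of "inverse \<alpha>" N] assms False by (simp add: norm_inverse inverse_le_1_iff)
qed

section \<open>Coefficients and the mean of the logarithm\<close>

definition coeff_norm :: "complex poly \<Rightarrow> real" where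
  "coeff_norm p = (\<Sum>i\<le>degree p. cmod (coeff p i))"

lemma coeff_norm_upto: "degree p \<le> n \<Longrightarrow> coeff_norm p = (\<Sum>i\<le>n. cmod (coeff p i))"
  unfolding coeff_norm_def by (rule sum.mono_neutral_left) (auto simp: coeff_eq_0)

lemma coeff_norm_add: "coeff_norm (p + q) \<le> coeff_norm p + coeff_norm q"
proof -
  let ?n = "max (degree p) (degree q)"
  have "coeff_norm (p + q) = (\<Sum>i\<le>?n. cmod (coeff p i + coeff q i))"
    by (subst coeff_norm_upto[of _ ?n]) (auto simp: degree_add_le)
  also have "\<dots> \<le> (\<Sum>i\<le>?n. cmod (coeff p i) + cmod (coeff q i))"
    by (intro sum_mono norm_triangle_ineq)
  also have "\<dots> = coeff_norm p + coeff_norm q"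
    by (simp add: coeff_norm_upto[of _ ?n] sum.distrib)
  finally show ?thesis .
qed

lemma coeff_norm_smult: "coeff_norm (smult a p) = cmod a * coeff_norm p"
  by (subst coeff_norm_upto[of _ "degree p"]) (auto simp: degree_smult_le coeff_norm_def norm_mult sum_distrib_left)

lemma coeff_norm_pCons_0: "coeff_norm (pCons 0 p) = coeff_norm p"
  by (subst coeff_norm_upto[of _ "Suc (degree p)"]) (auto simp: coeff_norm_def sum.atMost_Suc_shift degree_pCons_le simp del: sum.atMost_Suc)

lemma coeff_norm_monom: "coeff_norm (monom c n) = cmod c"
  by (subst coeff_norm_upto[of _ n]) (auto simp: degree_monom_le if_distrib sum.delta' cong: if_cong)

lemma coeff_norm_sum: "coeff_norm (\<Sum>x\<in>A. p x) \<le> (\<Sum>x\<in>A. coeff_norm (p x))"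
  by (induction A rule: infinite_finite_induct)
     (auto simp: coeff_norm_def[of 0] intro: order_trans[OF coeff_norm_add])

lemma norm_coeff_le_coeff_norm: "cmod (coeff p k) \<le> coeff_norm p"
proof (cases "k \<le> degree p")
  case True
  then show ?thesis unfolding coeff_norm_def
    by (intro member_le_sum[of k _ "\<lambda>i. cmod (coeff p i)"]) auto
next
  case False
  then show ?thesis by (simp add: coeff_eq_0 coeff_norm_def sum_nonneg)
qed

lemma coeff_norm_pos: "p \<noteq> 0 \<Longrightarrow> coeff_norm p > 0"
  using norm_coeff_le_coeff_norm[of p "degree p"] by (meson less_le_trans zero_less_norm_iff leading_coeff_neq_0)

lemma norm_poly_le_coeff_norm:
  assumes "cmod z = 1" shows "cmod (poly p z) \<le> coeff_norm p"
proof -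
  have "cmod (poly p z) \<le> (\<Sum>i\<le>degree p. cmod (coeff p i * z ^ i))"
    unfolding poly_altdef by (rule norm_sum)
  then show ?thesis using assms by (simp add: coeff_norm_def norm_mult norm_power)
qed

lemma coeff_norm_linear_factor:
  "coeff_norm ([:- \<alpha>, 1:] * q) \<le> 2 * max 1 (cmod \<alpha>) * coeff_norm q"
proof -
  have "coeff_norm ([:- \<alpha>, 1:] * q) = coeff_norm (smult (- \<alpha>) q + pCons 0 q)"
    by (simp add: mult_pCons_left)
  also have "\<dots> \<le> (cmod \<alpha> + 1) * coeff_norm q"
    using coeff_norm_add[of "smult (- \<alpha>) q" "pCons 0 q"]
    unfolding coeff_norm_smult coeff_norm_pCons_0 by (simp add: distrib_right)
  also have "\<dots> \<le> 2 * max 1 (cmod \<alpha>) * coeff_norm q"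
    by (intro mult_right_mono) (auto simp: coeff_norm_def sum_nonneg)
  finally show ?thesis .
qed

text \<open>
  This is the inequality \<open>|p|\<^sub>1 \<le> 2\<^sup>m M(p)\<close> between the coefficient norm and the Mahler measure \<open>M(p)\<close> of a
  polynomial of degree \<open>m\<close>. A linear factor \<open>z - \<alpha>\<close> multiplies the coefficient norm at most by
  \<open>2 max 1 |\<alpha>|\<close>, which is also a bound for the factor on the circle, and by \<open>linear_factor_deficit\<close> it costs at most
  \<open>ln 2\<close> relative to this bound. The polynomial is evaluated at \<open>z\<^sup>N\<close> rather than \<open>z\<close>
  because decimations only contain \<open>N\<close>th powers.
\<close>

lemma polynomial_deficit:
  assumes "p \<noteq> 0" "N \<ge> 1"
  shows "(\<integral>\<^sup>+t. log_deficit (coeff_norm p) (poly p (circ t ^ N)) \<partial>unit_measure)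
    \<le> ennreal (real (degree p) * ln 2)"
  using assms(1)
proof (induction "degree p" arbitrary: p)
  case 0
  then obtain c where "p = [:c:]" "c \<noteq> 0" by (metis degree_eq_zeroE pCons_0_0)
  then show ?case by (simp add: coeff_norm_def log_deficit_def)
next
  case (Suc n)
  then have "\<not> constant (poly p)" by (simp add: constant_degree)
  then obtain \<alpha> where "poly p \<alpha> = 0" using fundamental_theorem_of_algebra by blast
  then obtain q where p: "p = [:- \<alpha>, 1:] * q" by (auto simp: poly_eq_0_iff_dvd elim: dvdE)
  have q: "q \<noteq> 0" using p Suc by auto
  have dp: "degree p = Suc (degree q)"
    using q unfolding p by (subst degree_mult_eq) auto
  have IH: "(\<integral>\<^sup>+t. log_deficit (coeff_norm q) (poly q (circ t ^ N)) \<partial>unit_measure) \<le> ennreal (real (degree q) * ln 2)"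
    using Suc.hyps(1)[of q] Suc.hyps(2) dp q by simp
  let ?L = "2 * max 1 (cmod \<alpha>)"
  have m: "(\<lambda>t. poly r (circ t ^ N)) \<in> borel_measurable borel" for r
    by (simp add: poly_altdef)
  note [measurable] = measurable_compose[OF m measurable_log_deficit]
  have "(\<integral>\<^sup>+t. log_deficit (coeff_norm p) (poly p (circ t ^ N)) \<partial>unit_measure)
    \<le> (\<integral>\<^sup>+t. log_deficit ?L (circ t ^ N - \<alpha>) + log_deficit (coeff_norm q) (poly q (circ t ^ N)) \<partial>unit_measure)"
  proof (rule nn_integral_mono)
    fix t
    have "log_deficit (coeff_norm p) (poly p (circ t ^ N)) \<le> log_deficit (?L * coeff_norm q) (poly p (circ t ^ N))"
      using coeff_norm_linear_factor[of \<alpha> q] coeff_norm_pos[OF Suc.prems] p by (intro log_deficit_mono) auto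
    also have "\<dots> = log_deficit (?L * coeff_norm q) ((circ t ^ N - \<alpha>) * poly q (circ t ^ N))"
      by (simp add: p algebra_simps)
    also have "\<dots> = log_deficit ?L (circ t ^ N - \<alpha>) + log_deficit (coeff_norm q) (poly q (circ t ^ N))"
    proof (rule log_deficit_mult)
      show "cmod (circ t ^ N - \<alpha>) \<le> ?L"
        using norm_triangle_ineq4[of "circ t ^ N" \<alpha>] by (simp add: norm_power max_def split: if_splits)
    qed (use q coeff_norm_pos norm_poly_le_coeff_norm in \<open>auto simp: norm_power\<close>)
    finally show "log_deficit (coeff_norm p) (poly p (circ t ^ N))
      \<le> log_deficit ?L (circ t ^ N - \<alpha>) + log_deficit (coeff_norm q) (poly q (circ t ^ N))" .
  qed
  also have "\<dots> = (\<integral>\<^sup>+t. log_deficit ?L (circ t ^ N - \<alpha>) \<partial>unit_measure)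
    + (\<integral>\<^sup>+t. log_deficit (coeff_norm q) (poly q (circ t ^ N)) \<partial>unit_measure)"
    by (rule nn_integral_add) simp_all
  also have "\<dots> \<le> ennreal (ln 2) + ennreal (real (degree q) * ln 2)"
    by (intro add_mono linear_factor_deficit assms IH)
  also have "\<dots> = ennreal (real (degree p) * ln 2)"
    by (simp add: dp ennreal_plus[symmetric] distrib_right del: ennreal_plus)
  finally show ?case .
qed

lemma circ_powi: "circ t powi n = circ (of_int n * t)"
  by (simp only: circ_def cis_power_int) (simp add: mult_ac)

lemma norm_circ_powi [simp]: "cmod (circ t powi n) = 1"
  by (simp add: norm_power_int)

text \<open>
  The one-variable inequality for Laurent polynomials with exponents \<open>N l\<close>, \<open>|l| \<le> C\<close>: multiplication by \<open>z\<^sup>N\<^sup>C\<close>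
  changes no absolute value on the circle and yields a polynomial of degree at most \<open>2 C\<close> in \<open>z\<^sup>N\<close>. The
  exponents \<open>e n\<close> may repeat, and the coefficient of \<open>z\<^sup>k\<close> is a sum; in several variables, terms with the same
  exponent of the current variable have to be collected.
\<close>

lemma circle_deficit:
  fixes c :: "'a \<Rightarrow> complex" and e :: "'a \<Rightarrow> int"
  assumes "finite A" "N \<ge> 1" and e: "\<And>n. n \<in> A \<Longrightarrow> \<exists>l. e n = int N * l \<and> \<bar>l\<bar> \<le> int C"
    and K: "K > 0" "(\<Sum>n\<in>A. cmod (c n)) \<le> K"
  shows "(\<integral>\<^sup>+t. log_deficit K (\<Sum>n\<in>A. c n * circ t powi e n) \<partial>unit_measure)
    \<le> log_deficit K (\<Sum>n\<in>{n\<in>A. e n = k}. c n) + ennreal (2 * real C * ln 2)"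
proof (cases "(\<Sum>n\<in>{n\<in>A. e n = k}. c n) = 0")
  case False
  obtain l where l: "\<And>n. n \<in> A \<Longrightarrow> e n = int N * l n \<and> \<bar>l n\<bar> \<le> int C"
    using e by metis
  define j where "j n = nat (l n + int C)" for n
  have j: "int (j n) = l n + int C" if "n \<in> A" for n
    using l[OF that] unfolding j_def by auto
  define p where "p = (\<Sum>n\<in>A. monom (c n) (j n))"
  let ?a = "\<Sum>n\<in>{n\<in>A. e n = k}. c n"
  obtain n0 where n0: "n0 \<in> A" "e n0 = k" using False by (metis (mono_tags, lifting) mem_Collect_eq sum.not_neutral_contains_not_neutral)
  have iff: "j n = j n0 \<longleftrightarrow> e n = k" if "n \<in> A" for n
    using l[OF that] l[OF n0(1)] j[OF that] j[OF n0(1)] n0(2) \<open>N \<ge> 1\<close> by auto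
  have "coeff p (j n0) = (\<Sum>n\<in>A. if e n = k then c n else 0)"
    unfolding p_def coeff_sum coeff_monom by (intro sum.cong) (auto simp: iff)
  also have "\<dots> = ?a" using \<open>finite A\<close> by (simp add: sum.inter_filter)
  finally have coeff: "coeff p (j n0) = ?a" .
  with False have p: "p \<noteq> 0" by auto
  have pK: "coeff_norm p \<le> K"
    unfolding p_def by (rule order_trans[OF coeff_norm_sum]) (simp add: coeff_norm_monom K)
  have deg: "degree p \<le> 2 * C"
    unfolding p_def
  proof (intro degree_sum_le \<open>finite A\<close>)
    fix n assume "n \<in> A"
    then have "j n \<le> 2 * C" using l j by force
    then show "degree (monom (c n) (j n)) \<le> 2 * C" using degree_monom_le order_trans by blast
  qed
  have "log_deficit K (\<Sum>n\<in>A. c n * circ t powi e n)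
      = log_deficit (coeff_norm p) (poly p (circ t ^ N)) + ennreal (ln (K / coeff_norm p))" for t
  proof -
    have "poly p (circ t ^ N) = (\<Sum>n\<in>A. circ (real N * real C * t) * (c n * circ t powi e n))"
      unfolding p_def poly_sum poly_monom
    proof (rule sum.cong)
      fix n assume "n \<in> A"
      have "real_of_int (e n) + real N * real C = real N * real (j n)"
        using l[OF \<open>n \<in> A\<close>] j[OF \<open>n \<in> A\<close>]
        by (metis distrib_left of_int_add of_int_mult of_int_of_nat_eq)
      then have "real N * real C * t + of_int (e n) * t = real (N * j n) * t"
        by (metis add.commute distrib_right of_nat_mult)
      then have "circ (real (N * j n) * t) = circ (real N * real C * t) * circ t powi e n"
        by (metis circ_add circ_powi)
      moreover have "(circ t ^ N) ^ j n = circ (real (N * j n) * t)"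
        by (metis circ_power power_mult)
      ultimately have "(circ t ^ N) ^ j n = circ (real N * real C * t) * circ t powi e n"
        by simp
      then show "c n * (circ t ^ N) ^ j n = circ (real N * real C * t) * (c n * circ t powi e n)"
        by simp
    qed simp
    also have "\<dots> = circ (real N * real C * t) * (\<Sum>n\<in>A. c n * circ t powi e n)"
      by (simp add: sum_distrib_left)
    finally have "log_deficit K (\<Sum>n\<in>A. c n * circ t powi e n) = log_deficit K (poly p (circ t ^ N))"
      by (intro log_deficit_cong) (simp add: norm_mult)
    also have "\<dots> = log_deficit (coeff_norm p) (poly p (circ t ^ N)) + ennreal (ln (K / coeff_norm p))"
      by (intro log_deficit_scale coeff_norm_pos p pK norm_poly_le_coeff_norm) (simp add: norm_power)
    finally show ?thesis .
  qed
  then have "(\<integral>\<^sup>+t. log_deficit K (\<Sum>n\<in>A. c n * circ t powi e n) \<partial>unit_measure)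
    = (\<integral>\<^sup>+t. log_deficit (coeff_norm p) (poly p (circ t ^ N)) \<partial>unit_measure) + ennreal (ln (K / coeff_norm p))"
    by (simp add: nn_integral_add unit_measure.emeasure_space_1[simplified] poly_altdef)
  also have "\<dots> \<le> ennreal (real (degree p) * ln 2) + ennreal (ln (K / coeff_norm p))"
    by (intro add_right_mono polynomial_deficit p assms)
  also have "\<dots> \<le> ennreal (2 * real C * ln 2) + log_deficit K ?a"
  proof (intro add_mono ennreal_leI mult_right_mono)
    have "ln (K / coeff_norm p) \<le> ln (K / cmod ?a)"
      using False coeff norm_coeff_le_coeff_norm[of p "j n0"] K(1) coeff_norm_pos[OF p]
      by (intro ln_mono divide_left_mono) auto
    then show "ennreal (ln (K / coeff_norm p)) \<le> log_deficit K ?a"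
      using False by (simp add: log_deficit_def ennreal_leI)
  qed (use deg in auto)
  finally show ?thesis by (simp add: add.commute)
qed simp

text \<open>
  Induction on the set of variables. For fixed values of the others, \<open>circle_deficit\<close> in the variable \<open>i\<close>
  replaces the Laurent polynomial by its coefficient of the \<open>k i\<close>th power of that variable, which is a Laurent
  polynomial in the remaining variables.
\<close>

lemma torus_deficit:
  fixes c :: "'a \<Rightarrow> complex" and e :: "'a \<Rightarrow> 'd \<Rightarrow> int"
  assumes "finite I" "finite A" "N \<ge> 1"
    and e: "\<And>n i. n \<in> A \<Longrightarrow> i \<in> I \<Longrightarrow> \<exists>l. e n i = int N * l \<and> \<bar>l\<bar> \<le> int C"
    and K: "K > 0" "(\<Sum>n\<in>A. cmod (c n)) \<le> K"
  shows "(\<integral>\<^sup>+s. log_deficit K (\<Sum>n\<in>A. c n * (\<Prod>i\<in>I. circ (s i) powi e n i)) \<partial>torus_measure I)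
    \<le> log_deficit K (\<Sum>n\<in>{n\<in>A. \<forall>i\<in>I. e n i = k i}. c n) + ennreal (real (card I) * (2 * real C * ln 2))"
  using assms(1,2) e K(2)
proof (induction I arbitrary: A c rule: finite_induct)
  case empty
  then show ?case by (simp add: torus.nn_integral_empty PiM_empty)
next
  case (insert i I)
  let ?B = "{n\<in>A. e n i = k i}"
  let ?D = "2 * real C * ln 2"
  have m [measurable]: "(\<lambda>s. circ (s j) powi z) \<in> borel_measurable (torus_measure J)" if "j \<in> J" for j z and J :: "'d set"
    unfolding circ_powi using that by measurable
  have mP: "(\<lambda>s. \<Prod>i\<in>J. circ (s i) powi e n i) \<in> borel_measurable (torus_measure J)" for n J
    by (intro borel_measurable_prod m)
  have mf: "(\<lambda>s. log_deficit K (\<Sum>n\<in>X. c n * (\<Prod>i\<in>J. circ (s i) powi e n i))) \<in> borel_measurable (torus_measure J)" for X c J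
    by (intro measurable_compose[OF _ measurable_log_deficit] borel_measurable_sum borel_measurable_times borel_measurable_const mP)
  have "(\<integral>\<^sup>+s. log_deficit K (\<Sum>n\<in>A. c n * (\<Prod>j\<in>insert i I. circ (s j) powi e n j)) \<partial>torus_measure (insert i I))
    = (\<integral>\<^sup>+s. \<integral>\<^sup>+t. log_deficit K (\<Sum>n\<in>A. c n * (\<Prod>j\<in>insert i I. circ ((s(i := t)) j) powi e n j)) \<partial>unit_measure \<partial>torus_measure I)"
    by (rule torus.product_nn_integral_insert[OF insert.hyps mf])
  also have "\<dots> = (\<integral>\<^sup>+s. \<integral>\<^sup>+t. log_deficit K (\<Sum>n\<in>A. (c n * (\<Prod>j\<in>I. circ (s j) powi e n j)) * circ t powi e n i) \<partial>unit_measure \<partial>torus_measure I)"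
  proof (intro nn_integral_cong arg_cong[of _ _ "log_deficit K"] sum.cong refl)
    fix s t n
    have "(\<Prod>j\<in>I. circ ((s(i := t)) j) powi e n j) = (\<Prod>j\<in>I. circ (s j) powi e n j)"
      using insert.hyps by (intro prod.cong) auto
    then show "c n * (\<Prod>j\<in>insert i I. circ ((s(i := t)) j) powi e n j)
      = (c n * (\<Prod>j\<in>I. circ (s j) powi e n j)) * circ t powi e n i"
      using insert.hyps by (simp add: mult_ac)
  qed
  also have "\<dots> \<le> (\<integral>\<^sup>+s. log_deficit K (\<Sum>n\<in>?B. c n * (\<Prod>j\<in>I. circ (s j) powi e n j)) + ennreal ?D \<partial>torus_measure I)"
  proof (intro nn_integral_mono circle_deficit[where N = N and C = C] \<open>N \<ge> 1\<close> K(1) insert.prems(1))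
    show "(\<Sum>n\<in>A. cmod (c n * (\<Prod>j\<in>I. circ (s j) powi e n j))) \<le> K" for s
      using insert.prems(3) by (simp add: norm_mult prod_norm[symmetric])
  qed (use insert.prems(2) in auto)
  also have "\<dots> = (\<integral>\<^sup>+s. log_deficit K (\<Sum>n\<in>?B. c n * (\<Prod>j\<in>I. circ (s j) powi e n j)) \<partial>torus_measure I) + ennreal ?D"
  proof -
    have "emeasure (torus_measure I) (space (torus_measure I)) = 1"
      by (intro prob_space.emeasure_space_1 prob_space_PiM prob_space_unit_measure)
    then show ?thesis by (subst nn_integral_add) (auto intro!: mf)
  qed
  also have "\<dots> \<le> (log_deficit K (\<Sum>n\<in>{n\<in>?B. \<forall>i\<in>I. e n i = k i}. c n) + ennreal (real (card I) * ?D)) + ennreal ?D"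
  proof (intro add_right_mono insert.IH)
    have "(\<Sum>n\<in>?B. cmod (c n)) \<le> (\<Sum>n\<in>A. cmod (c n))"
      using insert.prems by (intro sum_mono2) auto
    then show "(\<Sum>n\<in>?B. cmod (c n)) \<le> K" using insert.prems by simp
  qed (use insert.prems in auto)
  also have "{n\<in>?B. \<forall>i\<in>I. e n i = k i} = {n\<in>A. \<forall>j\<in>insert i I. e n j = k j}"
    by auto
  also have "ennreal (real (card (insert i I)) * ?D) = ennreal (real (card I) * ?D) + ennreal ?D"
    using insert.hyps by (subst ennreal_plus[symmetric]) (auto simp: algebra_simps)
  then have "(log_deficit K (\<Sum>n\<in>{n\<in>A. \<forall>j\<in>insert i I. e n j = k j}. c n) + ennreal (real (card I) * ?D)) + ennreal ?D
    = log_deficit K (\<Sum>n\<in>{n\<in>A. \<forall>j\<in>insert i I. e n j = k j}. c n) + ennreal (real (card (insert i I)) * ?D)"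
    by (simp add: add.assoc)
  finally show ?case .
qed

section \<open>The Ronkin function\<close>

text \<open>
  The integral over the unit cube in the definition of the Ronkin function becomes an integral over the
  product measure.
\<close>

lemma torus_measure_eq_density:
  "torus_measure (UNIV :: 'd::finite set)
    = density (PiM UNIV (\<lambda>_. lborel)) (\<lambda>s. ennreal (indicator (cbox 0 (1 :: real ^ 'd)) (\<chi> i. s i)))"
    (is "_ = density ?L ?g")
proof (rule torus.PiM_eqI[symmetric])
  interpret product_sigma_finite "\<lambda>_::'d. lborel :: real measure" by standard
  have box: "((\<chi> i. s i) \<in> cbox 0 (1 :: real ^ 'd)) \<longleftrightarrow> s \<in> Pi\<^sub>E UNIV (\<lambda>_. {0..1})" for s
    by (auto simp: mem_box_cart PiE_iff)
  have g: "?g s = indicator (Pi\<^sub>E UNIV (\<lambda>_. {0..1})) s" for s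
    by (simp add: indicator_def box)
  have gm: "?g \<in> borel_measurable ?L"
  proof -
    have "indicator (Pi\<^sub>E UNIV (\<lambda>_. {0..1})) \<in> borel_measurable ?L"
      by (intro borel_measurable_indicator sets_PiM_I_finite) auto
    then show ?thesis by (simp only: g)
  qed
  show "sets (density ?L ?g) = sets (torus_measure UNIV)"
    unfolding sets_density by (rule sets_PiM_cong) auto
  fix A :: "'d \<Rightarrow> real set" assume "\<And>i. i \<in> UNIV \<Longrightarrow> A i \<in> sets unit_measure"
  then have A [measurable]: "A i \<in> sets borel" for i by simp
  have PA: "Pi\<^sub>E UNIV B \<in> sets ?L" if "\<And>i. B i \<in> sets borel" for B
    using that by (intro sets_PiM_I_finite) auto
  have "emeasure (density ?L ?g) (Pi\<^sub>E UNIV A) = (\<integral>\<^sup>+s. ?g s * indicator (Pi\<^sub>E UNIV A) s \<partial>?L)"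
    by (rule emeasure_density[OF gm PA]) simp
  also have "\<dots> = (\<integral>\<^sup>+s. indicator (Pi\<^sub>E UNIV (\<lambda>i. {0..1} \<inter> A i)) s \<partial>?L)"
    unfolding g by (intro nn_integral_cong) (auto simp: indicator_def PiE_iff)
  also have "\<dots> = emeasure ?L (Pi\<^sub>E UNIV (\<lambda>i. {0..1} \<inter> A i))"
    by (rule nn_integral_indicator) (intro PA sets.Int, auto)
  also have "\<dots> = (\<Prod>i\<in>UNIV. emeasure lborel ({0..1} \<inter> A i))"
    by (rule emeasure_PiM) auto
  also have "\<dots> = (\<Prod>i\<in>UNIV. emeasure unit_measure (A i))"
    by (simp add: emeasure_unit_measure)
  finally show "emeasure (density ?L ?g) (Pi\<^sub>E UNIV A) = (\<Prod>i\<in>UNIV. emeasure unit_measure (A i))" .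
qed simp

definition torus_point :: "real ^ 'd \<Rightarrow> ('d \<Rightarrow> real) \<Rightarrow> complex ^ 'd" where
  "torus_point u s = (\<chi> i. of_real (exp (u $ i)) * circ (s i))"

lemma torus_point_nonzero: "torus_point u s $ i \<noteq> 0"
  by (simp add: torus_point_def)

lemma lmonom_torus_point:
  "lmonom (torus_point u s) n = of_real (exp (real_vec n \<bullet> u)) * (\<Prod>i\<in>UNIV. circ (s i) powi (n $ i))"
proof -
  have "(of_real (exp (u $ i)) :: complex) powi (n $ i) = of_real (exp (of_int (n $ i) * u $ i))" for i
    by (simp only: exp_power_int flip: of_real_power_int)
  then have "(\<Prod>i\<in>UNIV. (of_real (exp (u $ i)) :: complex) powi (n $ i)) = of_real (exp (real_vec n \<bullet> u))"
    by (simp only: real_vec_def inner_vec_def exp_sum[OF finite] of_real_prod) simp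
  then show ?thesis
    by (simp add: lmonom_def torus_point_def power_int_mult_distrib prod.distrib)
qed

lemma leval_torus_point:
  "leval f (torus_point u s) = (\<Sum>n\<in>Poly_Mapping.keys f.
    (Poly_Mapping.lookup f n * of_real (exp (real_vec n \<bullet> u))) * (\<Prod>i\<in>UNIV. circ (s i) powi (n $ i)))"
  by (simp add: leval_def lmonom_torus_point mult_ac)

lemma measurable_leval_torus_point [measurable]:
  "(\<lambda>s. leval f (torus_point u s)) \<in> borel_measurable (torus_measure UNIV)"
  unfolding leval_torus_point circ_powi by measurable

lemma ronkin_eq_torus_integral:
  "ronkin f u = (\<integral>s. ln (cmod (leval f (torus_point u s))) \<partial>torus_measure UNIV)"
proof -
  let ?L = "PiM UNIV (\<lambda>_::'a. lborel :: real measure)"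
  have sets: "sets ?L = sets (torus_measure UNIV)" by (intro sets_PiM_cong) auto
  have ex: "exp (2 * of_real pi * \<i> * of_real x) = circ x" for x
    by (simp add: circ_def cis_conv_exp mult_ac)
  define g where "g x = ln (cmod (leval f (torus_point u (\<lambda>i. x $ i))))" for x :: "real ^ 'a"
  have gm: "g \<in> borel_measurable borel"
    unfolding g_def leval_torus_point circ_powi by measurable
  have [measurable]: "(\<lambda>s. \<chi> i. s i) \<in> borel_measurable ?L"
    by (subst borel_measurable_euclidean_space) (auto simp: Basis_vec_def inner_axis)
  have m: "(\<lambda>s. ln (cmod (leval f (torus_point u s)))) \<in> borel_measurable ?L"
    unfolding measurable_cong_sets[OF sets refl] by measurable
  have "ronkin f u = (\<integral>x. indicator (cbox 0 1) x *\<^sub>R g x \<partial>lborel)"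
    by (simp add: ronkin_def set_lebesgue_integral_def g_def torus_point_def ex)
  also have "\<dots> = (\<integral>s. indicator (cbox 0 1) (\<chi> i. s i) *\<^sub>R g (\<chi> i. s i) \<partial>?L)"
    by (subst lborel_vec_eq_distr_PiM, rule integral_distr) (auto intro!: borel_measurable_times borel_measurable_indicator gm)
  also have "\<dots> = (\<integral>s. indicator (cbox 0 1) (\<chi> i. s i) *\<^sub>R ln (cmod (leval f (torus_point u s))) \<partial>?L)"
    by (simp add: g_def)
  also have "\<dots> = (\<integral>s. ln (cmod (leval f (torus_point u s))) \<partial>torus_measure UNIV)"
    unfolding torus_measure_eq_density
    by (subst integral_density[OF m]) (auto intro!: measurable_compose[of _ ?L borel "indicator (cbox 0 1)"] borel_measurable_indicator)
  finally show ?thesis .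
qed

text \<open>
  The logarithm of the largest term of a Laurent polynomial on the torus of points with moduli \<open>exp (u $ i)\<close>.
\<close>

definition log_height :: "'d::finite laurent \<Rightarrow> real ^ 'd \<Rightarrow> real" where
  "log_height g u = Max ((\<lambda>n. ln (cmod (Poly_Mapping.lookup g n)) + real_vec n \<bullet> u) ` Poly_Mapping.keys g)"

lemma prob_space_torus: "prob_space (torus_measure I)"
  by (intro prob_space_PiM prob_space_unit_measure)

text \<open>
  The two comparisons of the Ronkin function with \<open>log_height\<close>. Here \<open>torus_deficit\<close> is applied with
  \<open>K\<close> the sum of the absolute values of all terms on the torus. The deficit of a nonzero coefficient is
  finite, and therefore so is the integral of the deficit of the Laurent polynomial.
\<close>

context
  fixes g :: "'d::finite laurent" and u :: "real ^ 'd" and N C :: nat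
  assumes g: "g \<noteq> 0" and N: "N \<ge> 1"
    and keys: "\<And>n i. n \<in> Poly_Mapping.keys g \<Longrightarrow> \<exists>l. n $ i = int N * l \<and> \<bar>l\<bar> \<le> int C"
begin

private definition weight where
  "weight n = cmod (Poly_Mapping.lookup g n * of_real (exp (real_vec n \<bullet> u)))"

private definition total where "total = (\<Sum>n\<in>Poly_Mapping.keys g. weight n)"

private lemma keys_nonempty: "Poly_Mapping.keys g \<noteq> {}"
  using g by simp

private lemma weight_pos: "n \<in> Poly_Mapping.keys g \<Longrightarrow> weight n > 0"
  by (simp add: weight_def in_keys_iff)

private lemma ln_weight: "n \<in> Poly_Mapping.keys g \<Longrightarrow> ln (weight n) = ln (cmod (Poly_Mapping.lookup g n)) + real_vec n \<bullet> u"
  by (simp add: weight_def norm_mult ln_mult in_keys_iff)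

private lemma total_pos: "total > 0"
  unfolding total_def using keys_nonempty by (intro sum_pos weight_pos) auto

private lemma weight_le_total: "n \<in> Poly_Mapping.keys g \<Longrightarrow> weight n \<le> total"
  unfolding total_def by (intro member_le_sum) (auto simp: weight_def)

private lemma norm_leval_le: "cmod (leval g (torus_point u s)) \<le> total"
  unfolding leval_torus_point total_def weight_def
  by (rule order_trans[OF norm_sum]) (simp add: norm_mult prod_norm[symmetric])

private lemma deficit_le:
  assumes "n \<in> Poly_Mapping.keys g"
  shows "(\<integral>\<^sup>+s. log_deficit total (leval g (torus_point u s)) \<partial>torus_measure UNIV)
    \<le> ennreal (ln (total / weight n) + real CARD('d) * (2 * real C * ln 2))"
proof -
  have "(\<integral>\<^sup>+s. log_deficit total (leval g (torus_point u s)) \<partial>torus_measure UNIV)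
    \<le> log_deficit total (\<Sum>m\<in>{m\<in>Poly_Mapping.keys g. \<forall>i\<in>UNIV. m $ i = n $ i}. Poly_Mapping.lookup g m * of_real (exp (real_vec m \<bullet> u)))
      + ennreal (real CARD('d) * (2 * real C * ln 2))"
    unfolding leval_torus_point
    by (rule torus_deficit[where N = N]) (use N keys total_pos in \<open>auto simp: total_def weight_def\<close>)
  also have "{m\<in>Poly_Mapping.keys g. \<forall>i\<in>UNIV. m $ i = n $ i} = {n}"
    using assms by (auto simp: vec_eq_iff)
  also have "log_deficit total (\<Sum>m\<in>{n}. Poly_Mapping.lookup g m * of_real (exp (real_vec m \<bullet> u)))
    = ennreal (ln (total / weight n))"
    using weight_pos[OF assms] by (auto simp: log_deficit_def weight_def)
  also have "ennreal (ln (total / weight n)) + ennreal (real CARD('d) * (2 * real C * ln 2))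
    = ennreal (ln (total / weight n) + real CARD('d) * (2 * real C * ln 2))"
    using weight_pos[OF assms] weight_le_total[OF assms]
    by (intro ennreal_plus[symmetric]) (auto intro!: ln_ge_zero mult_nonneg_nonneg simp: le_divide_eq)
  finally show ?thesis .
qed

private lemma deficit_finite: "(\<integral>\<^sup>+s. log_deficit total (leval g (torus_point u s)) \<partial>torus_measure UNIV) < \<infinity>"
proof -
  obtain n where "n \<in> Poly_Mapping.keys g" using keys_nonempty by blast
  from deficit_le[OF this] show ?thesis by (rule le_less_trans) simp
qed

lemma AE_leval_nonzero_of_bounded_keys: "AE s in torus_measure UNIV. leval g (torus_point u s) \<noteq> 0"
proof -
  have "AE s in torus_measure UNIV. log_deficit total (leval g (torus_point u s)) \<noteq> \<infinity>"
    using deficit_finite by (intro nn_integral_PInf_AE measurable_compose[OF measurable_leval_torus_point measurable_log_deficit]) auto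
  then show ?thesis by eventually_elim auto
qed

private lemma deficit_eq:
  "(\<integral>\<^sup>+s. log_deficit total (leval g (torus_point u s)) \<partial>torus_measure UNIV)
    = (\<integral>\<^sup>+s. ennreal (ln (total / cmod (leval g (torus_point u s)))) \<partial>torus_measure UNIV)"
  by (rule nn_integral_cong_AE, rule AE_mp[OF AE_leval_nonzero_of_bounded_keys]) (simp add: log_deficit_def)

private lemma ln_ratio_nonneg: "AE s in torus_measure UNIV. 0 \<le> ln (total / cmod (leval g (torus_point u s)))"
  by (rule AE_mp[OF AE_leval_nonzero_of_bounded_keys]) (auto intro!: ln_ge_zero simp: le_divide_eq norm_leval_le)

private lemma integrable_ln_ratio:
  "integrable (torus_measure UNIV) (\<lambda>s. ln (total / cmod (leval g (torus_point u s))))"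
  by (rule integrableI_nonneg) (use ln_ratio_nonneg deficit_finite deficit_eq in auto)

private lemma ln_leval_eq:
  "AE s in torus_measure UNIV. ln total - ln (total / cmod (leval g (torus_point u s))) = ln (cmod (leval g (torus_point u s)))"
  by (rule AE_mp[OF AE_leval_nonzero_of_bounded_keys]) (use total_pos in \<open>auto simp: ln_div\<close>)

lemma integrable_ln_leval_of_bounded_keys:
  "integrable (torus_measure UNIV) (\<lambda>s. ln (cmod (leval g (torus_point u s))))"
proof -
  interpret T: prob_space "torus_measure (UNIV :: 'd set)" by (rule prob_space_torus)
  have "integrable (torus_measure UNIV) (\<lambda>s. ln total - ln (total / cmod (leval g (torus_point u s))))"
    using integrable_ln_ratio by (intro Bochner_Integration.integrable_diff) auto
  then show ?thesis
    by (subst (asm) integrable_cong_AE[OF _ _ ln_leval_eq]) auto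
qed

private lemma ronkin_eq: "ronkin g u = ln total - (\<integral>s. ln (total / cmod (leval g (torus_point u s))) \<partial>torus_measure UNIV)"
proof -
  interpret T: prob_space "torus_measure (UNIV :: 'd set)" by (rule prob_space_torus)
  have "ronkin g u = (\<integral>s. ln total - ln (total / cmod (leval g (torus_point u s))) \<partial>torus_measure UNIV)"
    unfolding ronkin_eq_torus_integral by (rule integral_cong_AE) (use ln_leval_eq in auto)
  then show ?thesis
    using integrable_ln_ratio by (simp add: Bochner_Integration.integral_diff prob_space.prob_space[OF prob_space_torus])
qed

lemma ronkin_le_log_height: "ronkin g u \<le> log_height g u + ln (real (card (Poly_Mapping.keys g)))"
proof -
  let ?k = "real (card (Poly_Mapping.keys g))"
  have k: "?k > 0" using keys_nonempty by (simp add: card_gt_0_iff)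
  have "weight n \<le> exp (log_height g u)" if "n \<in> Poly_Mapping.keys g" for n
  proof -
    have "ln (weight n) \<le> log_height g u"
      unfolding log_height_def ln_weight[OF that] using that by (intro Max_ge) auto
    then show ?thesis using weight_pos[OF that] by (metis exp_le_cancel_iff exp_ln)
  qed
  then have "total \<le> ?k * exp (log_height g u)"
    unfolding total_def by (intro sum_bounded_above)
  then have "ln total \<le> ln (?k * exp (log_height g u))"
    using total_pos k by (intro ln_mono) auto
  also have "\<dots> = log_height g u + ln ?k"
    using k by (simp add: ln_mult g)
  finally show ?thesis
    using integral_nonneg_AE[OF ln_ratio_nonneg] unfolding ronkin_eq by simp
qed

lemma log_height_le_ronkin: "log_height g u \<le> ronkin g u + real CARD('d) * (2 * real C * ln 2)"
proof -
  have "ln (weight n) \<le> ronkin g u + real CARD('d) * (2 * real C * ln 2)" if n: "n \<in> Poly_Mapping.keys g" for n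
  proof -
    have "ennreal (\<integral>s. ln (total / cmod (leval g (torus_point u s))) \<partial>torus_measure UNIV)
      \<le> ennreal (ln (total / weight n) + real CARD('d) * (2 * real C * ln 2))"
      using deficit_le[OF n] unfolding deficit_eq
      by (subst nn_integral_eq_integral[symmetric]) (use integrable_ln_ratio ln_ratio_nonneg in auto)
    moreover have "ln (total / weight n) \<ge> 0"
      using weight_pos[OF n] weight_le_total[OF n] by (auto intro!: ln_ge_zero simp: le_divide_eq)
    ultimately have "(\<integral>s. ln (total / cmod (leval g (torus_point u s))) \<partial>torus_measure UNIV)
      \<le> ln (total / weight n) + real CARD('d) * (2 * real C * ln 2)"
      by (subst (asm) ennreal_le_iff) auto
    then show ?thesis
      using total_pos weight_pos[OF n] unfolding ronkin_eq by (simp add: ln_div)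
  qed
  then show ?thesis
    unfolding log_height_def using keys_nonempty by (subst Max_le_iff) (auto simp: ln_weight)
qed

end

lemma keys_bounded: "\<exists>C. \<forall>n\<in>Poly_Mapping.keys g. \<forall>i. \<bar>n $ i\<bar> \<le> int C" for g :: "'d::finite laurent"
proof -
  let ?S = "(\<lambda>(n, i). nat \<bar>n $ i\<bar>) ` (Poly_Mapping.keys g \<times> UNIV)"
  have "\<forall>n\<in>Poly_Mapping.keys g. \<forall>i. nat \<bar>n $ i\<bar> \<le> Max ?S"
    by (auto intro!: Max_ge)
  then show ?thesis by (intro exI[of _ "Max ?S"]) (simp add: nat_le_iff)
qed

lemma AE_leval_nonzero:
  assumes "g \<noteq> 0" shows "AE s in torus_measure UNIV. leval g (torus_point u s) \<noteq> 0"
proof -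
  obtain C where "\<forall>n\<in>Poly_Mapping.keys g. \<forall>i. \<bar>n $ i\<bar> \<le> int C" using keys_bounded by blast
  then show ?thesis using assms by (intro AE_leval_nonzero_of_bounded_keys[where N = 1 and C = C]) auto
qed

lemma integrable_ln_leval:
  assumes "g \<noteq> 0"
  shows "integrable (torus_measure UNIV) (\<lambda>s. ln (cmod (leval g (torus_point u s))))"
proof -
  obtain C where "\<forall>n\<in>Poly_Mapping.keys g. \<forall>i. \<bar>n $ i\<bar> \<le> int C" using keys_bounded by blast
  then show ?thesis using assms by (intro integrable_ln_leval_of_bounded_keys[where N = 1 and C = C]) auto
qed

lemma exists_leval_nonzero:
  assumes "g \<noteq> 0" shows "\<exists>s. leval g (torus_point u s) \<noteq> 0"
proof (rule ccontr)
  interpret T: prob_space "torus_measure (UNIV :: 'a set)" by (rule prob_space_torus)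
  assume "\<nexists>s. leval g (torus_point u s) \<noteq> 0"
  then have "AE s in torus_measure (UNIV :: 'a set). False"
    using AE_leval_nonzero[OF assms, of u] by auto
  then show False by simp
qed

text \<open>
  Laurent polynomials are determined by their values, because nonzero ones have nonzero values almost
  everywhere on a torus.
\<close>

lemma laurent_eqI:
  assumes "\<And>x. (\<And>i. x $ i \<noteq> 0) \<Longrightarrow> leval f x = leval g x"
  shows "f = g"
proof (rule ccontr)
  assume "f \<noteq> g"
  then have "f - g \<noteq> 0" by simp
  then obtain s where "leval (f - g) (torus_point 0 s) \<noteq> 0" using exists_leval_nonzero by blast
  moreover have "leval (f - g) x + leval g x = leval f x" for x
    by (simp flip: leval_add)
  then have "leval (f - g) (torus_point 0 s) + leval g (torus_point 0 s) = leval g (torus_point 0 s)"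
    using assms[of "torus_point 0 s"] by (simp add: torus_point_nonzero)
  ultimately show False by simp
qed

section \<open>Ronkin function and coefficients of a decimation\<close>

abbreviation decimation_index :: "nat \<Rightarrow> (nat ^ 'd::finite) set" where
  "decimation_index N \<equiv> {k. \<forall>i. k $ i < N}"

lemma card_vec_PiE: "card {v :: 'a ^ 'd::finite. \<forall>i. v $ i \<in> S} = card S ^ CARD('d)"
proof -
  have "bij_betw (\<lambda>g. \<chi> i. g i) (PiE UNIV (\<lambda>_ :: 'd. S)) {v. \<forall>i. v $ i \<in> S}"
    by (rule bij_betw_byWitness[of _ "\<lambda>v i. v $ i"]) (auto simp: PiE_iff)
  then have "card {v :: 'a ^ 'd. \<forall>i. v $ i \<in> S} = card (PiE UNIV (\<lambda>_ :: 'd. S))"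
    by (metis bij_betw_same_card)
  then show ?thesis by (simp add: card_PiE)
qed

lemma card_decimation_index: "card (decimation_index N :: (nat ^ 'd::finite) set) = N ^ CARD('d)"
  using card_vec_PiE[of "{..<N}", where 'd = 'd] by simp

lemma leval_decimation_circ:
  assumes "\<forall>i. x $ i \<noteq> 0"
  shows "leval (decimation N f) x = (\<Prod>k\<in>decimation_index N. leval f (\<chi> i. circ (real (k $ i) / real N) * x $ i))"
proof -
  have "exp (2 * of_real pi * \<i> * of_nat k / of_nat N) = circ (real k / real N)" for k
    by (simp add: circ_def cis_conv_exp mult_ac)
  then show ?thesis using leval_decimation[OF assms, of N f] by simp
qed

lemma leval_decimation_torus_point:
  "leval (decimation N f) (torus_point u s)
    = (\<Prod>k\<in>decimation_index N. leval f (torus_point u (\<lambda>i. s i + real (k $ i) / real N)))"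
  by (subst leval_decimation_circ) (simp_all add: torus_point_nonzero, simp add: torus_point_def circ_add mult_ac)

lemma
  fixes a :: "'d::finite \<Rightarrow> real"
  assumes "f \<noteq> 0"
  shows AE_leval_nonzero_shift: "AE s in torus_measure UNIV. leval f (torus_point u (\<lambda>i. s i + a i)) \<noteq> 0"
    and integrable_ln_leval_shift:
      "integrable (torus_measure UNIV) (\<lambda>s. ln (cmod (leval f (torus_point u (\<lambda>i. s i + a i)))))"
    and integral_ln_leval_shift:
      "(\<integral>s. ln (cmod (leval f (torus_point u (\<lambda>i. s i + a i)))) \<partial>torus_measure UNIV) = ronkin f u"
proof -
  let ?T = "torus_measure (UNIV :: 'd set)" and ?r = "\<lambda>s i. frac (s i + a i)"
  have "(\<lambda>t::real. frac (t + a i)) \<in> borel_measurable borel" for i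
    unfolding frac_def by measurable
  then have "(\<lambda>s. \<lambda>i\<in>UNIV. frac (s i + a i)) \<in> ?T \<rightarrow>\<^sub>M ?T"
    by (intro measurable_restrict measurable_compose[OF measurable_component_singleton]) simp_all
  then have m: "?r \<in> ?T \<rightarrow>\<^sub>M ?T"
    by (subst (asm) restrict_UNIV)
  have fr: "torus_point u (?r s) = torus_point u (\<lambda>i. s i + a i)" for s
    by (simp add: torus_point_def)
  have mf: "(\<lambda>s. ln (cmod (leval f (torus_point u s)))) \<in> borel_measurable ?T"
    by measurable
  have "AE s in distr ?T ?T ?r. leval f (torus_point u s) \<noteq> 0"
    unfolding distr_torus_frac by (rule AE_leval_nonzero[OF assms])
  from AE_distrD[OF m this] show "AE s in ?T. leval f (torus_point u (\<lambda>i. s i + a i)) \<noteq> 0"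
    by (simp only: fr)
  have "integrable (distr ?T ?T ?r) (\<lambda>s. ln (cmod (leval f (torus_point u s))))"
    unfolding distr_torus_frac by (rule integrable_ln_leval[OF assms])
  from integrable_distr[OF m this] show "integrable ?T (\<lambda>s. ln (cmod (leval f (torus_point u (\<lambda>i. s i + a i)))))"
    by (simp only: fr)
  have "ronkin f u = (\<integral>s. ln (cmod (leval f (torus_point u s))) \<partial>distr ?T ?T ?r)"
    unfolding distr_torus_frac by (rule ronkin_eq_torus_integral)
  also have "\<dots> = (\<integral>s. ln (cmod (leval f (torus_point u (?r s)))) \<partial>?T)"
    by (rule integral_distr[OF m mf])
  finally show "(\<integral>s. ln (cmod (leval f (torus_point u (\<lambda>i. s i + a i)))) \<partial>?T) = ronkin f u"
    by (simp only: fr)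
qed

lemma AE_decimation_factors_nonzero:
  fixes f :: "'d::finite laurent"
  assumes "f \<noteq> 0"
  shows "AE s in torus_measure UNIV. \<forall>k\<in>decimation_index N.
    leval f (torus_point u (\<lambda>i. s i + real (k $ i) / real N)) \<noteq> 0"
  by (intro AE_finite_allI finite_decimation_index AE_leval_nonzero_shift assms)

lemma decimation_nonzero:
  fixes f :: "'d::finite laurent"
  assumes "f \<noteq> 0" shows "decimation N f \<noteq> 0"
proof
  assume 0: "decimation N f = 0"
  have "leval (decimation N f) (torus_point 0 s) = 0" for s
    unfolding 0 by (simp add: leval_def)
  then have z: "(\<Prod>k\<in>decimation_index N. leval f (torus_point 0 (\<lambda>i. s i + real (k $ i) / real N))) = 0" for s
    by (simp only: leval_decimation_torus_point)
  have "AE s in torus_measure (UNIV :: 'd set). False"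
    using AE_decimation_factors_nonzero[OF assms, of N 0]
  proof eventually_elim
    case (elim s)
    then show False using z[of s] by (simp add: finite_decimation_index)
  qed
  then show False
    using prob_space.AE_False[OF prob_space_torus[of "UNIV :: 'd set"]] by simp
qed

text \<open>
  The factors of the decimation are rotations of \<open>f\<close>, all with the same mean of \<open>log |f|\<close>. The logarithm
  of the product splits only where all the factors are nonzero, which is almost everywhere.
\<close>

lemma ronkin_decimation:
  fixes f :: "'d::finite laurent"
  assumes "f \<noteq> 0"
  shows "ronkin (decimation N f) u = real N ^ CARD('d) * ronkin f u"
proof -
  let ?T = "torus_measure (UNIV :: 'd set)"
  let ?l = "\<lambda>k s. ln (cmod (leval f (torus_point u (\<lambda>i. s i + real (k $ i) / real N))))"
  have "ronkin (decimation N f) u = (\<integral>s. (\<Sum>k\<in>decimation_index N. ?l k s) \<partial>?T)"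
    unfolding ronkin_eq_torus_integral
  proof (rule integral_cong_AE)
    show "AE s in ?T. ln (cmod (leval (decimation N f) (torus_point u s))) = (\<Sum>k\<in>decimation_index N. ?l k s)"
      using AE_decimation_factors_nonzero[OF assms, of N u]
    proof eventually_elim
      case (elim s)
      then show ?case
        unfolding leval_decimation_torus_point prod_norm[symmetric]
        by (intro ln_prod) (auto simp: finite_decimation_index)
    qed
    show "(\<lambda>s. \<Sum>k\<in>decimation_index N. ?l k s) \<in> borel_measurable ?T"
      by (intro borel_measurable_sum borel_measurable_integrable integrable_ln_leval_shift assms)
  qed measurable
  also have "\<dots> = (\<Sum>k\<in>decimation_index N. (\<integral>s. ?l k s \<partial>?T))"
    by (intro Bochner_Integration.integral_sum integrable_ln_leval_shift assms)
  also have "\<dots> = real (card (decimation_index N :: (nat ^ 'd) set)) * ronkin f u"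
    by (simp add: integral_ln_leval_shift[OF assms])
  finally show ?thesis by (simp add: card_decimation_index)
qed

lemma circ_mod: "N > 0 \<Longrightarrow> circ (real (m mod N) / real N) = circ (real m / real N)"
proof -
  assume N: "N > 0"
  have "real m / real N = of_int (int (m div N)) + real (m mod N) / real N"
  proof -
    have "real m = real N * real (m div N) + real (m mod N)"
      by (metis mult_div_mod_eq of_nat_add of_nat_mult)
    then show ?thesis using N by (simp add: add_divide_distrib)
  qed
  then show ?thesis by (simp only: circ_add circ_int) simp
qed

lemma circ_eq_1_iff: "circ x = 1 \<longleftrightarrow> x \<in> \<int>"
proof
  assume "circ x = 1"
  then have "cos (2 * pi * x) = 1" by (metis circ_def cis.simps(1) one_complex.simps(1))
  then obtain n :: int where "2 * pi * x = real_of_int n * 2 * pi"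
    by (auto simp: cos_one_2pi_int)
  then have "x = of_int n" by simp
  then show "x \<in> \<int>" by simp
qed (auto elim!: Ints_cases)

text \<open>
  Multiplying the variable \<open>x\<^sub>j\<close> by \<open>e\<^sup>2\<^sup>\<pi>\<^sup>i\<^sup>/\<^sup>N\<close> permutes the factors cyclically.
\<close>

lemma leval_decimation_rotate:
  fixes f :: "'d::finite laurent"
  assumes N: "N > 0" and x: "\<forall>i. x $ i \<noteq> 0"
  shows "leval (decimation N f) (\<chi> i. (if i = j then circ (1 / real N) else 1) * x $ i)
    = leval (decimation N f) x"
proof -
  let ?\<phi> = "\<lambda>k :: nat ^ 'd. \<chi> i. if i = j then (k $ i + 1) mod N else k $ i"
  \<comment> \<open>The inverse of \<open>?\<phi>\<close> modulo \<open>N\<close>: adding \<open>N - 1\<close> instead of subtracting 1 avoids truncation.\<close>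
  let ?\<psi> = "\<lambda>k :: nat ^ 'd. \<chi> i. if i = j then (k $ i + (N - 1)) mod N else k $ i"
  let ?G = "\<lambda>k. leval f (\<chi> i. circ (real (k $ i) / real N) * x $ i)"
  have "leval (decimation N f) (\<chi> i. (if i = j then circ (1 / real N) else 1) * x $ i)
    = (\<Prod>k\<in>decimation_index N. ?G (?\<phi> k))"
  proof (subst leval_decimation_circ)
    have "(\<chi> i. circ (real (k $ i) / real N) * (\<chi> i. (if i = j then circ (1 / real N) else 1) * x $ i) $ i)
      = (\<chi> i. circ (real (?\<phi> k $ i) / real N) * x $ i)" for k :: "nat ^ 'd"
      unfolding vec_eq_iff
    proof
      fix i
      have "circ (real ((k $ i + 1) mod N) / real N) = circ (real (k $ i) / real N) * circ (1 / real N)"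
        unfolding circ_mod[OF N] circ_add[symmetric] by (simp add: add_divide_distrib add.commute)
      then show "(\<chi> i. circ (real (k $ i) / real N) * (\<chi> i. (if i = j then circ (1 / real N) else 1) * x $ i) $ i) $ i
        = (\<chi> i. circ (real (?\<phi> k $ i) / real N) * x $ i) $ i"
        by (cases "i = j") auto
    qed
    then show "(\<Prod>k\<in>decimation_index N. leval f (\<chi> i. circ (real (k $ i) / real N) *
        (\<chi> i. (if i = j then circ (1 / real N) else 1) * x $ i) $ i)) = (\<Prod>k\<in>decimation_index N. ?G (?\<phi> k))"
      by (simp only:)
  qed (use x in auto)
  also have "\<dots> = (\<Prod>k\<in>decimation_index N. ?G k)"
  proof (rule prod.reindex_bij_witness[of _ ?\<psi> ?\<phi>])
    fix k :: "nat ^ 'd" assume "k \<in> decimation_index N"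
    then have k: "k $ i < N" for i by simp
    have "k $ j + 1 + (N - 1) = k $ j + N" "k $ j + (N - 1) + 1 = k $ j + N"
      using N by auto
    then have "((k $ j + 1) mod N + (N - 1)) mod N = k $ j" "((k $ j + (N - 1)) mod N + 1) mod N = k $ j"
      using k[of j] by (simp_all only: mod_add_left_eq) simp_all
    then show "?\<psi> (?\<phi> k) = k" "?\<phi> (?\<psi> k) = k" by (simp_all add: vec_eq_iff)
    show "?\<phi> k \<in> decimation_index N" "?\<psi> k \<in> decimation_index N" using k N by auto
  qed simp
  also have "\<dots> = leval (decimation N f) x"
    by (rule leval_decimation_circ[OF x, symmetric])
  finally show ?thesis .
qed

lemma lookup_rescale_vars: "Poly_Mapping.lookup (rescale_vars z f) n = lmonom z n * Poly_Mapping.lookup f n"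
  by (simp add: rescale_vars_def lookup_mapp when_def in_keys_iff)

text \<open>
  By \<open>leval_decimation_rotate\<close>, the coefficient of \<open>x\<^sup>n\<close> is unchanged under multiplication by the \<open>n\<^sub>j\<close>th power
  of \<open>e\<^sup>2\<^sup>\<pi>\<^sup>i\<^sup>/\<^sup>N\<close>; hence this power is 1 if the coefficient is not 0.
\<close>

lemma keys_decimation_dvd:
  fixes f :: "'d::finite laurent"
  assumes N: "N > 0" and n: "n \<in> Poly_Mapping.keys (decimation N f)"
  shows "int N dvd n $ j"
proof -
  define t :: "complex ^ 'd" where "t = (\<chi> i. if i = j then circ (1 / real N) else 1)"
  have "rescale_vars t (decimation N f) = decimation N f"
    by (rule laurent_eqI) (simp add: leval_rescale_vars t_def leval_decimation_rotate[OF N])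
  then have "lmonom t n * Poly_Mapping.lookup (decimation N f) n = Poly_Mapping.lookup (decimation N f) n"
    by (metis lookup_rescale_vars)
  then have "lmonom t n = 1" using n by (simp add: in_keys_iff)
  moreover have "lmonom t n = (\<Prod>i\<in>UNIV. if i = j then circ (1 / real N) powi (n $ j) else 1)"
    unfolding lmonom_def t_def by (intro prod.cong) auto
  ultimately have "circ (of_int (n $ j) / real N) = 1"
    by (simp add: circ_powi)
  then obtain l :: int where "of_int (n $ j) / real N = of_int l"
    by (auto simp: circ_eq_1_iff elim!: Ints_cases)
  then have "real_of_int (n $ j) = real_of_int (int N * l)"
    using N by (simp add: field_simps)
  then have "n $ j = int N * l" by (simp only: of_int_eq_iff)
  then show ?thesis by simp
qed

lemma keys_prod_bounded:
  fixes g :: "'a \<Rightarrow> 'd::finite laurent"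
  assumes "\<And>a n. a \<in> A \<Longrightarrow> n \<in> Poly_Mapping.keys (g a) \<Longrightarrow> \<bar>n $ i\<bar> \<le> C"
    and "n \<in> Poly_Mapping.keys (prod g A)"
  shows "\<bar>n $ i\<bar> \<le> C * int (card A)"
  using assms
proof (induction A arbitrary: n rule: infinite_finite_induct)
  case (insert a A)
  from insert.prems(2) have "n \<in> Poly_Mapping.keys (g a * prod g A)" using insert.hyps by simp
  then obtain p q where "n = p + q" "p \<in> Poly_Mapping.keys (g a)" "q \<in> Poly_Mapping.keys (prod g A)"
    using keys_mult[of "g a" "prod g A"] by blast
  moreover from this have "\<bar>p $ i\<bar> \<le> C" "\<bar>q $ i\<bar> \<le> C * int (card A)"
    using insert by auto
  ultimately show ?case using insert.hyps by (simp add: algebra_simps)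
qed (auto simp flip: single_one)

lemma keys_decimation_bounded:
  fixes f :: "'d::finite laurent"
  assumes "\<forall>n\<in>Poly_Mapping.keys f. \<forall>i. \<bar>n $ i\<bar> \<le> int C"
    and "n \<in> Poly_Mapping.keys (decimation N f)"
  shows "\<bar>n $ i\<bar> \<le> int C * int N ^ CARD('d)"
proof -
  have "\<bar>n $ i\<bar> \<le> int C * int (card (decimation_index N :: (nat ^ 'd) set))"
  proof (rule keys_prod_bounded)
    show "n \<in> Poly_Mapping.keys (\<Prod>k\<in>decimation_index N. rescale_vars (torsion_point N k) f)"
      using assms(2) by (simp add: decimation_def)
    show "\<bar>m $ i\<bar> \<le> int C" if "m \<in> Poly_Mapping.keys (rescale_vars z f)" for m z
      using that assms(1) by (auto simp: in_keys_iff lookup_rescale_vars)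
  qed
  then show ?thesis by (simp add: card_decimation_index)
qed

text \<open>
  The first error term is \<open>log_height_le_ronkin\<close>: in the \<open>N\<close>th powers of the variables the exponents of the decimation are
  at most \<open>C N\<^sup>d\<^sup>-\<^sup>1\<close>. The second one is \<open>ronkin_le_log_height\<close>: the decimation has at most \<open>(2 C N\<^sup>d + 1)\<^sup>d\<close>
  terms.
\<close>

lemma log_height_decimation_bounds:
  fixes f :: "'d::finite laurent"
  assumes f: "f \<noteq> 0" and N: "N \<ge> 1" and C: "\<forall>n\<in>Poly_Mapping.keys f. \<forall>i. \<bar>n $ i\<bar> \<le> int C"
  defines "M \<equiv> real N ^ CARD('d)"
  shows "\<bar>log_height (decimation N f) u / M - ronkin f u\<bar>
    \<le> real CARD('d) * (2 * real C * ln 2) / real N + real CARD('d) * ln (2 * real C * M + 1) / M"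
proof -
  let ?F = "decimation N f" and ?d = "CARD('d)"
  define C' where "C' = C * N ^ (?d - 1)"
  have NC: "N * C' = C * N ^ ?d"
    using power_Suc[of N "?d - 1"] by (simp add: C'_def mult_ac)
  have M: "M > 0" "real N * real (N ^ (?d - 1)) = M"
    using N power_Suc[of "real N" "?d - 1"] by (simp_all add: M_def)
  have F: "?F \<noteq> 0" by (rule decimation_nonzero[OF f])
  have keys: "\<exists>l. n $ i = int N * l \<and> \<bar>l\<bar> \<le> int C'" if "n \<in> Poly_Mapping.keys ?F" for n i
  proof -
    have "int N dvd n $ i" using N by (intro keys_decimation_dvd[OF _ that]) simp
    then obtain l where l: "n $ i = int N * l" by (rule dvdE)
    have "int N * \<bar>l\<bar> \<le> int C * int N ^ ?d"
      using keys_decimation_bounded[OF C that, of i] by (simp add: l abs_mult)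
    also have "\<dots> = int N * int C'" by (metis NC of_nat_mult of_nat_power)
    finally show ?thesis using N l by auto
  qed
  have R: "ronkin ?F u = M * ronkin f u" by (simp add: ronkin_decimation[OF f] M_def)
  have up: "log_height ?F u \<le> M * ronkin f u + real ?d * (2 * real C' * ln 2)"
    using log_height_le_ronkin[OF F N keys, of u] R by simp
  have "card (Poly_Mapping.keys ?F) \<le> card {v :: int ^ 'd. \<forall>i. v $ i \<in> {- int (C * N ^ ?d)..int (C * N ^ ?d)}}"
  proof (rule card_mono)
    show "finite {v :: int ^ 'd. \<forall>i. v $ i \<in> {- int (C * N ^ ?d)..int (C * N ^ ?d)}}"
      by (rule card_ge_0_finite) (subst card_vec_PiE, simp)
    show "Poly_Mapping.keys ?F \<subseteq> {v. \<forall>i. v $ i \<in> {- int (C * N ^ ?d)..int (C * N ^ ?d)}}"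
    proof (intro subsetI CollectI allI)
      fix v i assume "v \<in> Poly_Mapping.keys ?F"
      from keys_decimation_bounded[OF C this, of i]
      show "v $ i \<in> {- int (C * N ^ ?d)..int (C * N ^ ?d)}" by (auto simp: abs_le_iff)
    qed
  qed
  also have "\<dots> = (2 * (C * N ^ ?d) + 1) ^ ?d"
    unfolding card_vec_PiE by (simp add: nat_add_distrib nat_mult_distrib nat_power_eq)
  finally have "real (card (Poly_Mapping.keys ?F)) \<le> real ((2 * (C * N ^ ?d) + 1) ^ ?d)"
    by (rule of_nat_mono)
  also have "\<dots> = (2 * real C * M + 1) ^ ?d" by (simp add: M_def add.commute mult.assoc)
  finally have "ln (real (card (Poly_Mapping.keys ?F))) \<le> ln ((2 * real C * M + 1) ^ ?d)"
    using F by (intro ln_mono) (auto simp: card_gt_0_iff)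
  also have "\<dots> = real ?d * ln (2 * real C * M + 1)"
    using M by (intro ln_realpow)
  finally have low: "M * ronkin f u \<le> log_height ?F u + real ?d * ln (2 * real C * M + 1)"
    using ronkin_le_log_height[OF F N keys, of u] R by simp
  have "real C' / M = real C / real N"
    using M N by (simp add: C'_def field_simps)
  then have "real ?d * (2 * real C' * ln 2) / M = real ?d * (2 * real C * ln 2) / real N"
    by (metis (no_types, lifting) times_divide_eq_right mult.commute mult.assoc times_divide_eq_left)
  then have 1: "log_height ?F u / M - ronkin f u \<le> real ?d * (2 * real C * ln 2) / real N"
    using divide_right_mono[OF up, of M] M by (simp add: add_divide_distrib)
  have 2: "ronkin f u - log_height ?F u / M \<le> real ?d * ln (2 * real C * M + 1) / M"
    using divide_right_mono[OF low, of M] M by (simp add: add_divide_distrib)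
  have "real ?d * (2 * real C * ln 2) / real N \<ge> 0" "real ?d * ln (2 * real C * M + 1) / M \<ge> 0"
    using M by auto
  then show ?thesis using 1 2 by linarith
qed

lemma error_tendsto_0:
  "(\<lambda>N. real d * (2 * real C * ln 2) / real N + real d * ln (2 * real C * real N ^ d + 1) / real N ^ d)
    \<longlonglongrightarrow> 0" if "d > 0"
proof -
  have L: "((\<lambda>x. ln (2 * c * x + 1) / x) \<longlongrightarrow> 0) at_top" if "c \<ge> 0" for c :: real
  proof (rule tendsto_sandwich[of "\<lambda>_. 0" _ _ "\<lambda>x. ln ((2 * c + 1) * x) / x"])
    show "((\<lambda>x. ln ((2 * c + 1) * x) / x) \<longlongrightarrow> 0) at_top"
      using that by real_asymp
    show "eventually (\<lambda>x. ln (2 * c * x + 1) / x \<le> ln ((2 * c + 1) * x) / x) at_top"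
      using eventually_ge_at_top[of 1]
    proof eventually_elim
      case (elim x)
      have "2 * c * x \<ge> 0" using elim that by simp
      then have "ln (2 * c * x + 1) \<le> ln ((2 * c + 1) * x)"
        using elim by (intro ln_mono) (auto simp: algebra_simps)
      then show ?case using elim by (intro divide_right_mono) auto
    qed
    show "eventually (\<lambda>x. 0 \<le> ln (2 * c * x + 1) / x) at_top"
      using eventually_ge_at_top[of 1]
      by eventually_elim (use that in auto)
  qed simp
  have "filterlim (\<lambda>N. real N ^ d) at_top sequentially"
    using that by (intro filterlim_pow_at_top filterlim_real_sequentially)
  from filterlim_compose[OF L[of "real C"] this]
  have "(\<lambda>N. ln (2 * real C * real N ^ d + 1) / real N ^ d) \<longlonglongrightarrow> 0"
    by simp
  then have "(\<lambda>N. real d * (2 * real C * ln 2) / real N + real d * (ln (2 * real C * real N ^ d + 1) / real N ^ d))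
    \<longlonglongrightarrow> 0 + real d * 0"
    by (intro tendsto_intros lim_const_over_n)
  then show ?thesis by simp
qed

section \<open>Concave hulls and Legendre duality\<close>

lemma neg_legendre_dual_le: "- legendre_dual h r \<le> ereal (h u - r \<bullet> u)"
proof -
  have "ereal (r \<bullet> u - h u) \<le> legendre_dual h r"
    unfolding legendre_dual_def by (rule SUP_upper) simp
  then have "- legendre_dual h r \<le> - ereal (r \<bullet> u - h u)"
    by (simp only: ereal_minus_le_minus)
  then show ?thesis by simp
qed

lemma neg_legendre_dual_greatest:
  assumes "\<And>u. x \<le> ereal (h u - r \<bullet> u)"
  shows "x \<le> - legendre_dual h r"
proof -
  have "legendre_dual h r \<le> - x"
    unfolding legendre_dual_def
  proof (rule SUP_least)
    fix u
    have "- ereal (h u - r \<bullet> u) \<le> - x"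
      using assms[of u] by (simp only: ereal_minus_le_minus)
    then show "ereal (r \<bullet> u - h u) \<le> - x" by simp
  qed
  then have "- (- x) \<le> - legendre_dual h r"
    by (simp only: ereal_minus_le_minus)
  then show ?thesis by simp
qed

text \<open>
  Conjugation is monotone and commutes with the addition of constants.
\<close>

lemma neg_legendre_dual_perturb:
  assumes "\<And>u. h u \<le> h' u + e"
  shows "- legendre_dual h r \<le> - legendre_dual h' r + ereal e"
proof -
  have "- legendre_dual h r - ereal e \<le> - legendre_dual h' r"
  proof (rule neg_legendre_dual_greatest)
    fix u
    have "- legendre_dual h r \<le> ereal (h u - r \<bullet> u)" by (rule neg_legendre_dual_le)
    also have "\<dots> \<le> ereal (h' u - r \<bullet> u) + ereal e" using assms[of u] by simp
    finally show "- legendre_dual h r - ereal e \<le> ereal (h' u - r \<bullet> u)"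
      by (simp add: ereal_minus_le)
  qed
  then show ?thesis by (simp add: ereal_minus_le)
qed

lemma concave_on_neg_legendre_dual:
  assumes "convex S" and fin: "\<And>r. r \<in> S \<Longrightarrow> \<bar>- legendre_dual h r\<bar> \<noteq> \<infinity>"
  shows "concave_on S (\<lambda>r. real_of_ereal (- legendre_dual h r))"
  unfolding concave_on_iff
proof (intro conjI ballI allI impI \<open>convex S\<close>)
  let ?D = "\<lambda>r. real_of_ereal (- legendre_dual h r)"
  fix x y and a b :: real assume *: "x \<in> S" "y \<in> S" "0 \<le> a" "0 \<le> b" "a + b = 1"
  have D: "- legendre_dual h r = ereal (?D r)" if "r \<in> S" for r
    using fin[OF that] by (cases "legendre_dual h r") auto
  have S: "a *\<^sub>R x + b *\<^sub>R y \<in> S" using assms(1) * by (simp add: convexD)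
  have "ereal (a * ?D x + b * ?D y) \<le> - legendre_dual h (a *\<^sub>R x + b *\<^sub>R y)"
  proof (rule neg_legendre_dual_greatest)
    fix u
    have "?D x \<le> h u - x \<bullet> u" "?D y \<le> h u - y \<bullet> u"
      using neg_legendre_dual_le[of h _ u] D * by (metis ereal_less_eq(3))+
    then have "a * ?D x + b * ?D y \<le> a * (h u - x \<bullet> u) + b * (h u - y \<bullet> u)"
      using * by (intro add_mono mult_left_mono)
    also have "\<dots> = (a + b) * h u - (a *\<^sub>R x + b *\<^sub>R y) \<bullet> u"
      by (simp add: inner_add_left algebra_simps)
    also have "\<dots> = h u - (a *\<^sub>R x + b *\<^sub>R y) \<bullet> u" using * by simp
    finally show "ereal (a * ?D x + b * ?D y) \<le> ereal (h u - (a *\<^sub>R x + b *\<^sub>R y) \<bullet> u)" by simp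
  qed
  then show "a * ?D x + b * ?D y \<le> ?D (a *\<^sub>R x + b *\<^sub>R y)"
    using D[OF S] by (metis ereal_less_eq(3))
qed

text \<open>
  Concave hulls of functions that are \<open>-\<infinity>\<close> off a finite set \<open>P\<close>. The affine functions with gradient \<open>-u\<close>
  that dominate such a function are those with constant term at least \<open>Max ((\<lambda>p. w p + p \<bullet> u) ` P)\<close>.
\<close>

context
  fixes P :: "(real ^ 'd::finite) set" and w :: "real ^ 'd \<Rightarrow> real"
  assumes P: "finite P" "P \<noteq> {}"
begin

private definition support where "support u = Max ((\<lambda>p. w p + p \<bullet> u) ` P)"

private lemma support_ge: "p \<in> P \<Longrightarrow> w p + p \<bullet> u \<le> support u"
  unfolding support_def using P by (intro Max_ge) auto

private lemma support_le: "(\<And>p. p \<in> P \<Longrightarrow> w p + p \<bullet> u \<le> b) \<Longrightarrow> support u \<le> b"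
  unfolding support_def using P by (intro Max.boundedI) auto

lemma concave_hull_eq_neg_legendre_dual:
  "concave_hull (\<lambda>r. if r \<in> P then ereal (w r) else -\<infinity>) r
    = - legendre_dual (\<lambda>u. Max ((\<lambda>p. w p + p \<bullet> u) ` P)) r"
proof -
  let ?g = "\<lambda>r. if r \<in> P then ereal (w r) else -\<infinity>"
  have "concave_hull ?g r = - legendre_dual support r"
  proof (rule antisym)
    show "concave_hull ?g r \<le> - legendre_dual support r"
    proof (rule neg_legendre_dual_greatest)
      fix u
      have "\<forall>s. ?g s \<le> ereal ((- u) \<bullet> s + support u)"
        using support_ge by (auto simp: inner_commute algebra_simps)
      then have "concave_hull ?g r \<le> ereal ((- u) \<bullet> r + support u)"
        unfolding concave_hull_def by (intro Inf_lower) blast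
      then show "concave_hull ?g r \<le> ereal (support u - r \<bullet> u)"
        by (simp add: inner_commute)
    qed
    show "- legendre_dual support r \<le> concave_hull ?g r"
      unfolding concave_hull_def
    proof (rule Inf_greatest, clarify)
      fix a b assume dom: "\<forall>s. ?g s \<le> ereal (a \<bullet> s + b)"
      have "w p + p \<bullet> (- a) \<le> b" if "p \<in> P" for p
        using spec[OF dom, of p] that by (simp add: inner_commute)
      then have "support (- a) \<le> b" by (rule support_le)
      then have "ereal (support (- a) - r \<bullet> (- a)) \<le> ereal (a \<bullet> r + b)"
        by (simp add: inner_commute)
      then show "- legendre_dual support r \<le> ereal (a \<bullet> r + b)"
        using neg_legendre_dual_le order_trans by blast
    qed
  qed
  then show ?thesis by (simp add: support_def[abs_def])
qed

text \<open>
  A point outside the convex hull of \<open>P\<close> is separated from it by a hyperplane, and multiples of the normal vector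
  send the infimum to \<open>-\<infinity>\<close>. In the convex hull, the smallest value of \<open>w\<close> is a lower bound.
\<close>

lemma neg_legendre_dual_Max_finite_iff:
  "\<bar>- legendre_dual (\<lambda>u. Max ((\<lambda>p. w p + p \<bullet> u) ` P)) r\<bar> \<noteq> \<infinity> \<longleftrightarrow> r \<in> convex hull P"
  "r \<notin> convex hull P \<Longrightarrow> - legendre_dual (\<lambda>u. Max ((\<lambda>p. w p + p \<bullet> u) ` P)) r = -\<infinity>"
proof -
  let ?D = "- legendre_dual support r"
  have fin: "\<bar>?D\<bar> \<noteq> \<infinity>" if r: "r \<in> convex hull P"
  proof -
    have "ereal (Min (w ` P)) \<le> ?D"
    proof (rule neg_legendre_dual_greatest)
      fix u
      have "convex hull P \<subseteq> {x. u \<bullet> x \<le> support u - Min (w ` P)}"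
      proof (rule hull_minimal)
        show "P \<subseteq> {x. u \<bullet> x \<le> support u - Min (w ` P)}"
        proof
          fix p assume p: "p \<in> P"
          then have "Min (w ` P) \<le> w p" using P by (intro Min_le) auto
          then show "p \<in> {x. u \<bullet> x \<le> support u - Min (w ` P)}"
            using support_ge[OF p, of u] by (simp add: inner_commute)
        qed
      qed (rule convex_halfspace_le)
      then show "ereal (Min (w ` P)) \<le> ereal (support u - r \<bullet> u)"
        using r by (auto simp: inner_commute)
    qed
    moreover have "?D \<le> ereal (support 0 - r \<bullet> 0)" by (rule neg_legendre_dual_le)
    ultimately show ?thesis by (cases ?D) auto
  qed
  have minf: "?D = -\<infinity>" if r: "r \<notin> convex hull P"
  proof -
    have "closed (convex hull P)"
      using P by (simp add: compact_convex_hull compact_imp_closed finite_imp_compact)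
    then obtain a b where ab: "a \<bullet> r < b" "\<And>x. x \<in> convex hull P \<Longrightarrow> b < a \<bullet> x"
      using separating_hyperplane_closed_point[OF convex_convex_hull _ r] by blast
    have "?D \<le> ereal B" for B
    proof -
      \<comment> \<open>At this multiple of the normal vector the separation by \<open>b - a \<bullet> r\<close> outweighs \<open>Max (w ` P) - B\<close>.\<close>
      define t where "t = max 0 ((Max (w ` P) - B) / (b - a \<bullet> r))"
      have t: "t \<ge> 0" "Max (w ` P) - B \<le> t * (b - a \<bullet> r)"
        using ab(1) unfolding t_def by (simp_all add: max_def field_simps) 
      have "support (- t *\<^sub>R a) \<le> Max (w ` P) - t * b"
      proof (rule support_le)
        fix p assume p: "p \<in> P"
        then have "w p \<le> Max (w ` P)" using P by (intro Max_ge) auto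
        moreover have "t * b \<le> t * (a \<bullet> p)"
          using ab(2)[OF hull_inc[OF p]] t(1) by (intro mult_left_mono) auto
        ultimately show "w p + p \<bullet> (- t *\<^sub>R a) \<le> Max (w ` P) - t * b"
          by (simp add: inner_commute)
      qed
      moreover have "r \<bullet> (- t *\<^sub>R a) = - (t * (a \<bullet> r))" by (simp add: inner_commute)
      ultimately have "support (- t *\<^sub>R a) - r \<bullet> (- t *\<^sub>R a) \<le> B"
        using t(2) by (simp add: right_diff_distrib inner_commute[of r])
      then show ?thesis
        using neg_legendre_dual_le[of support r "- t *\<^sub>R a"] by (metis ereal_less_eq(3) order_trans)
    qed
    then show ?thesis by (rule ereal_bot)
  qed
  show "\<bar>- legendre_dual (\<lambda>u. Max ((\<lambda>p. w p + p \<bullet> u) ` P)) r\<bar> \<noteq> \<infinity> \<longleftrightarrow> r \<in> convex hull P"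
    "r \<notin> convex hull P \<Longrightarrow> - legendre_dual (\<lambda>u. Max ((\<lambda>p. w p + p \<bullet> u) ` P)) r = -\<infinity>"
    unfolding support_def[abs_def, symmetric] using fin minf by (cases "r \<in> convex hull P"; simp)+
qed

text \<open>
  The polytope \<open>Q\<close> spanned by the points \<open>(p, w p)\<close> and their projections \<open>(p, c)\<close> to a low horizontal
  hyperplane is a finite intersection of half-spaces. Those with a positive last normal component bound \<open>Q\<close> from
  above and give the finite family of affine functions. The others hold on the floor of \<open>Q\<close>, and hence
  also above it.
\<close>

lemma neg_legendre_dual_Max_eq_finite_min:
  obtains F :: "((real ^ 'd) \<times> real) set" where "finite F" "F \<noteq> {}"
    "\<And>r t. r \<in> convex hull P \<Longrightarrow>
      ereal t \<le> - legendre_dual (\<lambda>u. Max ((\<lambda>p. w p + p \<bullet> u) ` P)) r \<longleftrightarrow> (\<forall>(u, b)\<in>F. t \<le> b - r \<bullet> u)"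
proof -
  \<comment> \<open>Any height at most \<open>Min (w ` P)\<close> serves as the floor.\<close>
  define c where "c = Min (w ` P) - 1"
  have c: "c \<le> w p" if "p \<in> P" for p
  proof -
    have "Min (w ` P) \<le> w p" using P that by (intro Min_le) auto
    then show ?thesis by (simp add: c_def)
  qed
  define Q where "Q = convex hull ((\<lambda>p. (p, w p)) ` P \<union> (\<lambda>p. (p, c)) ` P)"
  have "polyhedron Q"
    unfolding Q_def using P by (intro polytope_imp_polyhedron polytope_convex_hull) auto
  then obtain F where F: "finite F" "Q = \<Inter> F" "\<forall>h\<in>F. \<exists>a b. a \<noteq> 0 \<and> h = {x. a \<bullet> x \<le> b}"
    unfolding polyhedron_def by blast
  then obtain a b where ab: "\<And>h. h \<in> F \<Longrightarrow> h = {x. a h \<bullet> x \<le> b h}"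
    by metis
  define G where "G = {h \<in> F. snd (a h) > 0}"
  define E where "E = (\<lambda>h. (fst (a h) /\<^sub>R snd (a h), b h / snd (a h))) ` G"
  have Qmem: "x \<in> Q \<longleftrightarrow> (\<forall>h\<in>F. fst (a h) \<bullet> fst x + snd (a h) * snd x \<le> b h)" for x
    unfolding F(2) using ab by (auto simp: inner_prod_def)
  have floor: "(r, c) \<in> Q" if "r \<in> convex hull P" for r
  proof -
    have "convex {r. (r, c) \<in> Q}"
    proof (rule convexI, clarify)
      fix x y and u v :: real assume *: "(x, c) \<in> Q" "(y, c) \<in> Q" "0 \<le> u" "0 \<le> v" "u + v = 1"
      have "convex Q" by (simp add: Q_def)
      from convexD[OF this *] have "(u *\<^sub>R x + v *\<^sub>R y, (u + v) * c) \<in> Q" by (simp add: distrib_right)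
      then show "(u *\<^sub>R x + v *\<^sub>R y, c) \<in> Q" using * by simp
    qed
    then have "convex hull P \<subseteq> {r. (r, c) \<in> Q}"
      by (intro hull_minimal) (auto simp: Q_def intro!: hull_inc)
    then show ?thesis using that by auto
  qed
  have key: "ereal t \<le> - legendre_dual support r \<longleftrightarrow> (\<forall>(u, b)\<in>E. t \<le> b - r \<bullet> u)"
    if r: "r \<in> convex hull P" for r t
  proof
    assume t: "ereal t \<le> - legendre_dual support r"
    show "\<forall>(u, b)\<in>E. t \<le> b - r \<bullet> u"
      unfolding E_def
    proof clarify
      fix h assume h: "h \<in> G"
      let ?u = "fst (a h) /\<^sub>R snd (a h)" and ?b = "b h / snd (a h)"
      have pos: "snd (a h) > 0" "h \<in> F" using h by (auto simp: G_def)
      have "support ?u \<le> ?b"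
      proof (rule support_le)
        fix p assume "p \<in> P"
        then have "(p, w p) \<in> Q" unfolding Q_def by (intro hull_inc) auto
        then have "fst (a h) \<bullet> p + snd (a h) * w p \<le> b h" using Qmem pos by auto
        then have "w p \<le> (b h - fst (a h) \<bullet> p) / snd (a h)"
          using pos by (subst pos_le_divide_eq) (auto simp: mult.commute)
        then have "w p + (fst (a h) \<bullet> p) / snd (a h) \<le> ?b"
          by (simp add: diff_divide_distrib)
        then show "w p + p \<bullet> ?u \<le> ?b"
          by (simp add: divide_inverse inner_commute mult.commute)
      qed
      moreover have "t \<le> support ?u - r \<bullet> ?u"
        using order_trans[OF t neg_legendre_dual_le[of support r ?u]] by (simp only: ereal_less_eq)
      ultimately show "t \<le> ?b - r \<bullet> ?u" by simp
    qed
  next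
    assume t: "\<forall>(u, b)\<in>E. t \<le> b - r \<bullet> u"
    \<comment> \<open>Raising \<open>t\<close> to the floor puts the point into \<open>Q\<close> and only strengthens the claim.\<close>
    define t' where "t' = max t c"
    have "(r, t') \<in> Q"
      unfolding Qmem
    proof
      fix h assume h: "h \<in> F"
      have fl: "fst (a h) \<bullet> r + snd (a h) * c \<le> b h" using floor[OF r] Qmem h by auto
      have "fst (a h) \<bullet> r + snd (a h) * t' \<le> b h"
      proof (cases "snd (a h) > 0")
        case True
        then have "t \<le> b h / snd (a h) - r \<bullet> (fst (a h) /\<^sub>R snd (a h))"
          using t h by (auto simp: E_def G_def)
        then have "fst (a h) \<bullet> r + snd (a h) * t \<le> b h"
          using True by (simp add: field_simps inner_commute)
        then show ?thesis using fl by (simp add: t'_def max_def)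
      next
        case False
        then have "snd (a h) * t' \<le> snd (a h) * c"
          by (intro mult_left_mono_neg) (auto simp: t'_def)
        then show ?thesis using fl by simp
      qed
      then show "fst (a h) \<bullet> fst (r, t') + snd (a h) * snd (r, t') \<le> b h" by simp
    qed
    have "ereal t' \<le> - legendre_dual support r"
    proof (rule neg_legendre_dual_greatest)
      fix u
      have "Q \<subseteq> {x. (u, 1) \<bullet> x \<le> support u}"
        unfolding Q_def
      proof (rule hull_minimal)
        show "(\<lambda>p. (p, w p)) ` P \<union> (\<lambda>p. (p, c)) ` P \<subseteq> {x. (u, 1) \<bullet> x \<le> support u}"
        proof (intro Un_least image_subsetI CollectI)
          fix p assume p: "p \<in> P"
          show "(u, 1) \<bullet> (p, w p) \<le> support u"
            using support_ge[OF p, of u] by (simp add: inner_prod_def inner_commute)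
          show "(u, 1) \<bullet> (p, c) \<le> support u"
            using support_ge[OF p, of u] c[OF p] by (simp add: inner_prod_def inner_commute)
        qed
      qed (rule convex_halfspace_le)
      then show "ereal t' \<le> ereal (support u - r \<bullet> u)"
        using \<open>(r, t') \<in> Q\<close> by (auto simp: inner_prod_def inner_commute)
    qed
    moreover have "ereal t \<le> ereal t'" by (simp add: t'_def)
    ultimately show "ereal t \<le> - legendre_dual support r" by (rule order_trans[rotated])
  qed
  have "E \<noteq> {}"
  proof
    assume "E = {}"
    obtain p where "p \<in> P" using P by blast
    then have p: "p \<in> convex hull P" by (rule hull_inc)
    have "ereal t \<le> - legendre_dual support p" for t
      using key[OF p, of t] \<open>E = {}\<close> by simp
    then have "- legendre_dual support p = \<infinity>" by (rule ereal_top)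
    then show False
      using neg_legendre_dual_Max_finite_iff(1)[of p] p by (simp add: support_def[abs_def])
  qed
  moreover have "finite E" unfolding E_def G_def using F by simp
  ultimately show thesis using key by (intro that[of E]) (simp_all add: support_def[abs_def])
qed

end

lemma polyhedron_Times_UNIV:
  fixes S :: "'a::euclidean_space set"
  assumes "polyhedron S" shows "polyhedron (S \<times> (UNIV :: real set))"
proof -
  obtain F where F: "finite F" "S = \<Inter> F" "\<forall>h\<in>F. \<exists>a b. a \<noteq> 0 \<and> h = {x. a \<bullet> x \<le> b}"
    using assms unfolding polyhedron_def by blast
  have "S \<times> UNIV = \<Inter> ((\<lambda>h. h \<times> (UNIV :: real set)) ` F)" using F(2) by auto
  moreover have "polyhedron (h \<times> (UNIV :: real set))" if "h \<in> F" for h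
  proof -
    from bspec[OF F(3) that] obtain a b where "h = {x. a \<bullet> x \<le> b}" by (elim exE conjE)
    then have "h \<times> (UNIV :: real set) = {x. (a, 0) \<bullet> x \<le> b}" by (auto simp: inner_prod_def)
    then show ?thesis by (simp add: polyhedron_halfspace_le)
  qed
  then have "polyhedron (\<Inter> ((\<lambda>h. h \<times> (UNIV :: real set)) ` F))"
    using F(1) by (intro polyhedron_Inter) auto
  ultimately show ?thesis by simp
qed

lemma continuous_on_Min_finite:
  fixes f :: "'i \<Rightarrow> 'a::topological_space \<Rightarrow> real"
  assumes "finite F" "F \<noteq> {}" "\<And>i. i \<in> F \<Longrightarrow> continuous_on S (f i)"
  shows "continuous_on S (\<lambda>x. Min ((\<lambda>i. f i x) ` F))"
  using assms
proof (induction rule: finite_ne_induct)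
  case (insert i F)
  then show ?case by (simp add: continuous_on_min)
qed simp

text \<open>
  Both claims follow from the representation of the function as a minimum of finitely many affine
  functions.
\<close>

lemma polyhedral_neg_legendre_dual_Max:
  fixes P :: "(real ^ 'd::finite) set" and w :: "real ^ 'd \<Rightarrow> real"
  assumes P: "finite P" "P \<noteq> {}"
  defines "D \<equiv> \<lambda>r. - legendre_dual (\<lambda>u. Max ((\<lambda>p. w p + p \<bullet> u) ` P)) r"
  shows "concave_polyhedral_on (convex hull P) (\<lambda>r. real_of_ereal (D r))"
    and "continuous_on (convex hull P) (\<lambda>r. real_of_ereal (D r))"
proof -
  obtain F where F: "finite F" "F \<noteq> {}"
    "\<And>r t. r \<in> convex hull P \<Longrightarrow> ereal t \<le> D r \<longleftrightarrow> (\<forall>(u, b)\<in>F. t \<le> b - r \<bullet> u)"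
    using neg_legendre_dual_Max_eq_finite_min[OF P, of w] unfolding D_def by blast
  have fin: "\<bar>D r\<bar> \<noteq> \<infinity>" if "r \<in> convex hull P" for r
    using neg_legendre_dual_Max_finite_iff(1)[OF P, of w r] that unfolding D_def by simp
  have le: "t \<le> real_of_ereal (D r) \<longleftrightarrow> (\<forall>(u, b)\<in>F. t \<le> b - r \<bullet> u)" if "r \<in> convex hull P" for r t
    using F(3)[OF that, of t] fin[OF that] by (cases "D r") auto
  have "concave_on (convex hull P) (\<lambda>r. real_of_ereal (D r))"
    unfolding D_def by (rule concave_on_neg_legendre_dual) (use fin in \<open>auto simp: D_def\<close>)
  moreover have "{(r, t). r \<in> convex hull P \<and> t \<le> real_of_ereal (D r)}
    = (convex hull P) \<times> UNIV \<inter> \<Inter> ((\<lambda>(u, b). {x. (u, 1) \<bullet> x \<le> b}) ` F)"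
  proof (intro set_eqI)
    fix x :: "(real ^ 'd) \<times> real"
    have "x \<in> \<Inter> ((\<lambda>(u, b). {x. (u, 1) \<bullet> x \<le> b}) ` F) \<longleftrightarrow> (\<forall>(u, b)\<in>F. snd x \<le> b - fst x \<bullet> u)"
      by (simp add: case_prod_unfold inner_prod_def inner_commute[of "fst x"] algebra_simps)
    then show "x \<in> {(r, t). r \<in> convex hull P \<and> t \<le> real_of_ereal (D r)}
      \<longleftrightarrow> x \<in> (convex hull P) \<times> UNIV \<inter> \<Inter> ((\<lambda>(u, b). {x. (u, 1) \<bullet> x \<le> b}) ` F)"
      using le[of "fst x" "snd x"] by (cases x) auto
  qed
  moreover have "polyhedron ((convex hull P) \<times> (UNIV :: real set))"
    using P by (intro polyhedron_Times_UNIV polytope_imp_polyhedron polytope_convex_hull)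
  then have "polyhedron ((convex hull P) \<times> UNIV \<inter> \<Inter> ((\<lambda>(u, b). {x. (u, 1 :: real) \<bullet> x \<le> b}) ` F))"
    using F(1) by (intro polyhedron_Int polyhedron_Inter) (auto intro: polyhedron_halfspace_le)
  ultimately show "concave_polyhedral_on (convex hull P) (\<lambda>r. real_of_ereal (D r))"
    by (simp add: concave_polyhedral_on_def)
  have "real_of_ereal (D r) = Min ((\<lambda>(u, b). b - r \<bullet> u) ` F)" if "r \<in> convex hull P" for r
  proof (rule antisym)
    show "real_of_ereal (D r) \<le> Min ((\<lambda>(u, b). b - r \<bullet> u) ` F)"
      using F le[OF that, of "real_of_ereal (D r)"] by (auto intro!: Min.boundedI)
    show "Min ((\<lambda>(u, b). b - r \<bullet> u) ` F) \<le> real_of_ereal (D r)"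
      unfolding le[OF that] using F(1) by (auto intro!: Min_le)
  qed
  moreover have "continuous_on (convex hull P) (\<lambda>r. Min ((\<lambda>e. snd e - r \<bullet> fst e) ` F))"
    by (intro continuous_on_Min_finite F continuous_intros)
  ultimately show "continuous_on (convex hull P) (\<lambda>r. real_of_ereal (D r))"
    by (simp add: case_prod_unfold cong: continuous_on_cong)
qed

section \<open>Convergence of the renormalized decimations\<close>

lemma decimation_1: "decimation 1 f = f"
proof (rule laurent_eqI)
  fix x :: "complex ^ 'a" assume "\<And>i. x $ i \<noteq> 0"
  then have "leval (decimation 1 f) x
    = (\<Prod>k\<in>decimation_index 1. leval f (\<chi> i. circ (real (k $ i) / real 1) * x $ i))"
    by (intro leval_decimation_circ) simp
  also have "decimation_index 1 = {0 :: nat ^ 'a}" by (auto simp: vec_eq_iff)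
  finally show "leval (decimation 1 f) x = leval f x" by (simp add: circ_def)
qed

lemma coeff_ext_nonzeroE:
  assumes "coeff_ext f r \<noteq> 0"
  obtains n where "n \<in> Poly_Mapping.keys f" "r = real_vec n"
proof -
  have "\<forall>i. r $ i \<in> \<int>" "Poly_Mapping.lookup f (\<chi> i. \<lfloor>r $ i\<rfloor>) \<noteq> 0"
    using assms by (auto simp: coeff_ext_def split: if_splits)
  then show thesis
    by (intro that[of "\<chi> i. \<lfloor>r $ i\<rfloor>"]) (auto simp: in_keys_iff real_vec_def vec_eq_iff elim!: Ints_cases)
qed

text \<open>
  The points at which the logarithmic rescaling is finite.
\<close>

definition decimation_support :: "nat \<Rightarrow> 'd::finite laurent \<Rightarrow> (real ^ 'd) set" where
  "decimation_support N f = (\<lambda>n. real_vec n /\<^sub>R real N ^ CARD('d)) ` Poly_Mapping.keys (decimation N f)"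

lemma decimation_support_finite_nonempty:
  assumes "f \<noteq> 0" shows "finite (decimation_support N f)" "decimation_support N f \<noteq> {}"
  using decimation_nonzero[OF assms, of N] by (simp_all add: decimation_support_def)

lemma renormalized_decimation_eq:
  fixes f :: "'d::finite laurent"
  assumes f: "f \<noteq> 0" and N: "N \<ge> 1"
  defines "M \<equiv> real N ^ CARD('d)"
  defines "w \<equiv> \<lambda>r. ln (cmod (coeff_ext (decimation N f) (M *\<^sub>R r))) / M"
  shows "renormalized_decimation N f r
      = - legendre_dual (\<lambda>u. Max ((\<lambda>p. w p + p \<bullet> u) ` decimation_support N f)) r"
    and "Max ((\<lambda>p. w p + p \<bullet> u) ` decimation_support N f) = log_height (decimation N f) u / M"
proof -
  let ?F = "decimation N f"
  have M: "M > 0" using N by (simp add: M_def)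
  have "log_rescaling N f = (\<lambda>r. if r \<in> decimation_support N f then ereal (w r) else -\<infinity>)"
  proof
    fix r
    show "log_rescaling N f r = (if r \<in> decimation_support N f then ereal (w r) else -\<infinity>)"
    proof (cases "coeff_ext ?F (M *\<^sub>R r) = 0")
      case True
      have "r \<notin> decimation_support N f"
      proof
        assume "r \<in> decimation_support N f"
        then obtain n where "n \<in> Poly_Mapping.keys ?F" "M *\<^sub>R r = real_vec n"
          using M by (auto simp: decimation_support_def M_def)
        then show False using True by (simp add: coeff_ext_real_vec in_keys_iff)
      qed
      then show ?thesis using True M by (simp add: log_rescaling_def log_ext_def M_def)
    next
      case False
      then obtain n where n: "n \<in> Poly_Mapping.keys ?F" "M *\<^sub>R r = real_vec n"
        by (rule coeff_ext_nonzeroE)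
      then have "r = real_vec n /\<^sub>R M" using M by (simp flip: n(2))
      then have "r \<in> decimation_support N f" using n by (auto simp: decimation_support_def M_def)
      then show ?thesis using False
        by (simp add: log_rescaling_def log_ext_def w_def) (simp add: M_def)
    qed
  qed
  then show "renormalized_decimation N f r
      = - legendre_dual (\<lambda>u. Max ((\<lambda>p. w p + p \<bullet> u) ` decimation_support N f)) r"
    using concave_hull_eq_neg_legendre_dual[OF decimation_support_finite_nonempty[OF f]]
    by (simp add: renormalized_decimation_def)
  have "(\<lambda>p. w p + p \<bullet> u) ` decimation_support N f
    = (\<lambda>x. x / M) ` (\<lambda>n. ln (cmod (Poly_Mapping.lookup ?F n)) + real_vec n \<bullet> u) ` Poly_Mapping.keys ?F"
    unfolding decimation_support_def image_image M_def[symmetric] w_def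
    using M by (intro image_cong) (simp_all add: coeff_ext_real_vec field_simps)
  also have "Max \<dots> = log_height ?F u / M"
    unfolding log_height_def using decimation_nonzero[OF f, of N] M
    by (intro mono_Max_commute[symmetric]) (auto simp: mono_def divide_right_mono)
  finally show "Max ((\<lambda>p. w p + p \<bullet> u) ` decimation_support N f) = log_height ?F u / M" .
qed

lemma renormalized_decimation_eq_neg_legendre_dual:
  fixes f :: "'d::finite laurent"
  assumes "f \<noteq> 0" "N \<ge> 1"
  shows "renormalized_decimation N f r
    = - legendre_dual (\<lambda>u. log_height (decimation N f) u / real N ^ CARD('d)) r"
  using renormalized_decimation_eq[OF assms] by simp

lemma renormalized_decimation_domain:
  fixes f :: "'d::finite laurent"
  assumes "f \<noteq> 0" "N \<ge> 1"
  shows "\<bar>renormalized_decimation N f r\<bar> \<noteq> \<infinity> \<longleftrightarrow> r \<in> convex hull decimation_support N f"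
    and "r \<notin> convex hull decimation_support N f \<Longrightarrow> renormalized_decimation N f r = -\<infinity>"
  unfolding renormalized_decimation_eq(1)[OF assms]
  by (rule neg_legendre_dual_Max_finite_iff[OF decimation_support_finite_nonempty[OF assms(1)]])+

lemma renormalized_decimation_polyhedral:
  fixes f :: "'d::finite laurent"
  assumes "f \<noteq> 0" "N \<ge> 1"
  shows "concave_polyhedral_on (convex hull decimation_support N f) (\<lambda>r. real_of_ereal (renormalized_decimation N f r))"
    and "continuous_on (convex hull decimation_support N f) (\<lambda>r. real_of_ereal (renormalized_decimation N f r))"
  unfolding renormalized_decimation_eq(1)[OF assms]
  by (rule polyhedral_neg_legendre_dual_Max[OF decimation_support_finite_nonempty[OF assms(1)]])+

lemma newton_polytope_eq: "newton_polytope f = convex hull decimation_support 1 f"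
  by (simp add: newton_polytope_def decimation_support_def decimation_1[simplified])

text \<open>
  The uniform estimate on the functions \<open>h\<^sub>N\<close> and \<open>R\<^sub>f\<close> passes to their conjugates. The estimate is additive
  in the extended reals, so it also compares the domains of finiteness.
\<close>

lemma renormalized_decimation_near_neg_legendre_ronkin:
  fixes f :: "'d::finite laurent"
  assumes f: "f \<noteq> 0"
  obtains \<epsilon> :: "nat \<Rightarrow> real" where "\<epsilon> \<longlonglongrightarrow> 0"
    "\<And>N r. N \<ge> 1 \<Longrightarrow> renormalized_decimation N f r \<le> - legendre_dual (ronkin f) r + ereal (\<epsilon> N)"
    "\<And>N r. N \<ge> 1 \<Longrightarrow> - legendre_dual (ronkin f) r \<le> renormalized_decimation N f r + ereal (\<epsilon> N)"
proof -
  obtain C where C: "\<forall>n\<in>Poly_Mapping.keys f. \<forall>i. \<bar>n $ i\<bar> \<le> int C" using keys_bounded by blast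
  define \<epsilon> where "\<epsilon> N = real CARD('d) * (2 * real C * ln 2) / real N
    + real CARD('d) * ln (2 * real C * real N ^ CARD('d) + 1) / real N ^ CARD('d)" for N
  have close: "\<bar>log_height (decimation N f) u / real N ^ CARD('d) - ronkin f u\<bar> \<le> \<epsilon> N" if "N \<ge> 1" for N u
    using log_height_decimation_bounds[OF f that C, of u] by (simp add: \<epsilon>_def)
  show thesis
  proof (rule that[of \<epsilon>])
    show "\<epsilon> \<longlonglongrightarrow> 0"
      unfolding \<epsilon>_def[abs_def] by (rule error_tendsto_0) simp
    fix N :: nat and r :: "real ^ 'd" assume N: "N \<ge> 1"
    have "log_height (decimation N f) u / real N ^ CARD('d) \<le> ronkin f u + \<epsilon> N" for u
      using close[OF N, of u] by linarith
    then show "renormalized_decimation N f r \<le> - legendre_dual (ronkin f) r + ereal (\<epsilon> N)"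
      unfolding renormalized_decimation_eq_neg_legendre_dual[OF f N] by (rule neg_legendre_dual_perturb)
    have "ronkin f u \<le> log_height (decimation N f) u / real N ^ CARD('d) + \<epsilon> N" for u
      using close[OF N, of u] by linarith
    then show "- legendre_dual (ronkin f) r \<le> renormalized_decimation N f r + ereal (\<epsilon> N)"
      unfolding renormalized_decimation_eq_neg_legendre_dual[OF f N] by (rule neg_legendre_dual_perturb)
  qed
qed

theorem theorem1p2:
  fixes f :: "'d::finite laurent"
  assumes "f \<noteq> 0"
  shows "(\<forall>N\<ge>1.
            (\<forall>r\<in>newton_polytope f. \<bar>renormalized_decimation N f r\<bar> \<noteq> \<infinity>) \<and>
            concave_polyhedral_on (newton_polytope f)
              (\<lambda>r. real_of_ereal (renormalized_decimation N f r)) \<and>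
            (\<forall>r. r \<notin> newton_polytope f \<longrightarrow> renormalized_decimation N f r = -\<infinity>)) \<and>
         (\<exists>D :: real ^ 'd \<Rightarrow> ereal.
            (\<forall>r\<in>newton_polytope f. \<bar>D r\<bar> \<noteq> \<infinity>) \<and>
            continuous_on (newton_polytope f) (\<lambda>r. real_of_ereal (D r)) \<and>
            concave_on (newton_polytope f) (\<lambda>r. real_of_ereal (D r)) \<and>
            uniform_limit (newton_polytope f)
              (\<lambda>N r. real_of_ereal (renormalized_decimation N f r))
              (\<lambda>r. real_of_ereal (D r)) sequentially \<and>
            (\<forall>r. r \<notin> newton_polytope f \<longrightarrow> D r = -\<infinity>) \<and>
            (\<forall>r. D r = - legendre_dual (ronkin f) r))"
proof -
  let ?S = "newton_polytope f" and ?D = "\<lambda>r. - legendre_dual (ronkin f) r"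
  let ?DN = "\<lambda>N. renormalized_decimation N f"
  obtain \<epsilon> where eps: "\<epsilon> \<longlonglongrightarrow> 0"
    and le: "\<And>N r. N \<ge> 1 \<Longrightarrow> ?DN N r \<le> ?D r + ereal (\<epsilon> N)"
    and ge: "\<And>N r. N \<ge> 1 \<Longrightarrow> ?D r \<le> ?DN N r + ereal (\<epsilon> N)"
    using renormalized_decimation_near_neg_legendre_ronkin[OF assms] by blast
  \<comment> \<open>The first decimation is \<open>f\<close> itself, so its domain is the Newton polytope; it passes to the limit, and from there to all \<open>N\<close>.\<close>
  have D1: "\<bar>?DN 1 r\<bar> \<noteq> \<infinity> \<longleftrightarrow> r \<in> ?S" "r \<notin> ?S \<Longrightarrow> ?DN 1 r = -\<infinity>" for r
    using renormalized_decimation_domain[OF assms, of 1] by (auto simp: newton_polytope_eq)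
  have D_fin: "\<bar>?D r\<bar> \<noteq> \<infinity>" if "r \<in> ?S" for r
    using le[of 1 r] ge[of 1 r] D1(1)[of r] that by (cases "legendre_dual (ronkin f) r"; cases "?DN 1 r") auto
  have D_inf: "?D r = -\<infinity>" if "r \<notin> ?S" for r
    using ge[of 1 r] D1(2)[OF that] by auto
  have DN_fin: "\<bar>?DN N r\<bar> \<noteq> \<infinity>" if "N \<ge> 1" "r \<in> ?S" for N r
    using le[OF that(1), of r] ge[OF that(1), of r] D_fin[OF that(2)]
    by (cases "legendre_dual (ronkin f) r"; cases "?DN N r") auto
  have DN_inf: "?DN N r = -\<infinity>" if "N \<ge> 1" "r \<notin> ?S" for N r
    using le[OF that(1), of r] D_inf[OF that(2)] by auto
  have S: "?S = convex hull decimation_support N f" if "N \<ge> 1" for N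
    using renormalized_decimation_domain(1)[OF assms that] DN_fin[OF that] DN_inf[OF that]
    by (metis (no_types, lifting) abs_ereal.simps(2,3) ereal_infinity_cases set_eqI ereal_uminus_eq_reorder)
  have poly: "concave_polyhedral_on ?S (\<lambda>r. real_of_ereal (?DN N r))"
    and cont: "continuous_on ?S (\<lambda>r. real_of_ereal (?DN N r))" if "N \<ge> 1" for N
    using renormalized_decimation_polyhedral[OF assms that] by (simp_all add: S[OF that])
  have lim: "uniform_limit ?S (\<lambda>N r. real_of_ereal (?DN N r)) (\<lambda>r. real_of_ereal (?D r)) sequentially"
  proof (rule uniform_limitI)
    fix e :: real assume "e > 0"
    then have "eventually (\<lambda>N. \<epsilon> N < e) sequentially" using eps by (rule order_tendstoD(2)[rotated])
    then show "\<forall>\<^sub>F N in sequentially. \<forall>r\<in>?S. dist (real_of_ereal (?DN N r)) (real_of_ereal (?D r)) < e"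
      using eventually_ge_at_top[of 1]
    proof eventually_elim
      case (elim N)
      show ?case
      proof
        fix r assume r: "r \<in> ?S"
        have "\<bar>real_of_ereal (?DN N r) - real_of_ereal (?D r)\<bar> \<le> \<epsilon> N"
          using le[OF elim(2), of r] ge[OF elim(2), of r] D_fin[OF r] DN_fin[OF elim(2) r]
          by (cases "legendre_dual (ronkin f) r"; cases "?DN N r") auto
        then show "dist (real_of_ereal (?DN N r)) (real_of_ereal (?D r)) < e"
          using elim(1) by (simp add: dist_real_def)
      qed
    qed
  qed
  have "continuous_on ?S (\<lambda>r. real_of_ereal (?D r))"
    by (rule uniform_limit_theorem[OF _ lim])
       (auto intro!: eventually_mono[OF eventually_ge_at_top[of 1]] cont)
  moreover have "concave_on ?S (\<lambda>r. real_of_ereal (?D r))"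
  proof (rule concave_on_neg_legendre_dual)
    show "convex ?S" by (simp add: newton_polytope_def)
  qed (rule D_fin)
  ultimately show ?thesis
    using DN_fin DN_inf poly D_fin D_inf lim by (intro conjI exI[of _ ?D]) auto
qed

end
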